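(* Let $n\ge 2$, $\Omega\subset\mathbb{R}^n$ a domain, and $F\in W^{1,n}_{\mathrm{loc}}(\Omega;\mathbb{R}^n)$. Let $V:\mathbb{R}^n\to\mathbb{R}^n$ be a $C^1$ vector field with bounded derivative. Then $$\operatorname{div}\big((\operatorname{adj} DF)\,(V\circ F)\big)=\big[(\operatorname{div}V)\circ F\big]\,J_F$$ in the sense of distributions on $\Omega$, i.e. for every $\varphi\in C_0^\infty(\Omega)$, $$-\int_\Omega \big(\operatorname{adj}DF(x)\,V(F(x))\big)\cdot\nabla\varphi(x)\,dx=\int_\Omega (\operatorname{div}V)(F(x))\,J_F(x)\,\varphi(x)\,dx.$$
   Context: $J_F=\det DF$. The adjugate matrix $\operatorname{adj}(DF(x))$ is the matrix of cofactors defined by $DF(x)\cdot\operatorname{adj}(DF(x))=J_F(x)\,I_n$; its entries are homogeneous polynomials of degree $n-1$ in the partial derivatives $\partial F^i/\partial x_j$ (so that $\operatorname{adj}(DF)=J_F\,(DF)^{-1}$ when $J_F\neq 0$). The divergence of the vector field $(\operatorname{adj}DF)(V\circ F)$ is taken componentwise in the usual way. *)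

theory Defs
  imports "HOL-Analysis.Analysis"
begin

definition partial_deriv :: "'n::finite \<Rightarrow> (real^'n \<Rightarrow> real) \<Rightarrow> real^'n \<Rightarrow> real" where
  "partial_deriv j f x = frechet_derivative f (at x) (axis j 1)"

fun Ck_fun :: "nat \<Rightarrow> (real^'n::finite \<Rightarrow> real) set" where
  "Ck_fun 0 = {f. continuous_on UNIV f}"
| "Ck_fun (Suc k) = {f. (\<forall>x. f differentiable (at x)) \<and> (\<forall>j. partial_deriv j f \<in> Ck_fun k)}"

definition smooth_fun :: "(real^'n::finite \<Rightarrow> real) \<Rightarrow> bool" where
  "smooth_fun f \<longleftrightarrow> (\<forall>k. f \<in> Ck_fun k)"

definition test_fun :: "(real^'n::finite) set \<Rightarrow> (real^'n \<Rightarrow> real) \<Rightarrow> bool" where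
  "test_fun \<Omega> \<phi> \<longleftrightarrow> smooth_fun \<phi> \<and> compact (closure {x. \<phi> x \<noteq> 0}) \<and> closure {x. \<phi> x \<noteq> 0} \<subseteq> \<Omega>"

definition grad :: "(real^'n::finite \<Rightarrow> real) \<Rightarrow> real^'n \<Rightarrow> real^'n" where
  "grad f x = (\<chi> j. partial_deriv j f x)"

definition Lp_loc :: "real \<Rightarrow> (real^'n::finite) set \<Rightarrow> (real^'n \<Rightarrow> real) \<Rightarrow> bool" where
  "Lp_loc p \<Omega> g \<longleftrightarrow> set_borel_measurable lebesgue \<Omega> g \<and>
     (\<forall>K. compact K \<and> K \<subseteq> \<Omega> \<longrightarrow> set_integrable lebesgue K (\<lambda>x. \<bar>g x\<bar> powr p))"

definition weak_jacobian :: "(real^'n::finite) set \<Rightarrow> (real^'n \<Rightarrow> real^'n) \<Rightarrow> (real^'n \<Rightarrow> real^'n^'n) \<Rightarrow> bool" where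
  "weak_jacobian \<Omega> F DF \<longleftrightarrow>
     (\<forall>i j \<phi>. test_fun \<Omega> \<phi> \<longrightarrow>
        (LINT x:\<Omega>|lebesgue. F x $ i * partial_deriv j \<phi> x)
        = - (LINT x:\<Omega>|lebesgue. DF x $ i $ j * \<phi> x))"

definition W1p_loc :: "real \<Rightarrow> (real^'n::finite) set \<Rightarrow> (real^'n \<Rightarrow> real^'n) \<Rightarrow> (real^'n \<Rightarrow> real^'n^'n) \<Rightarrow> bool" where
  "W1p_loc p \<Omega> F DF \<longleftrightarrow>
     (\<forall>i. Lp_loc p \<Omega> (\<lambda>x. F x $ i)) \<and> (\<forall>i j. Lp_loc p \<Omega> (\<lambda>x. DF x $ i $ j)) \<and>
     weak_jacobian \<Omega> F DF"

(* adjugate (transposed cofactor matrix): adj A $ i $ j = det of A with row j replaced by e_i,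
   so that A ** adj A = det A *\<^sub>R mat 1 *)
definition adj :: "real^'n^'n \<Rightarrow> real^'n^'n::finite" where
  "adj A = (\<chi> i j. det (\<chi> k l. if k = j then (if l = i then 1 else 0) else A $ k $ l))"

definition mtrace :: "real^'n^'n \<Rightarrow> real" where
  "mtrace A = (\<Sum>i\<in>UNIV. A $ i $ i)"

end

theory Submission
  imports Defs "HOL-Probability.Probability_Measure"
begin

text \<open>
  For a map of class $C^2$ the identity is an integration by parts: the rows of the cofactor matrix are
  divergence free (Piola), and $DF \cdot \mathrm{adj}(DF) = J_F I$. In general, truncate $F$ and $DF$ to a
  compact neighbourhood of the support of the test function and mollify. The mollifications converge in
  $L^n$; a sequence whose errors are summable converges almost everywhere and is dominated by a function $h$
  with $h^n$ integrable. Both integrands are bounded by a multiple of $1 + |F|^n + |DF|^n$, since the adjugate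
  has degree $n - 1$ and $V$ grows at most linearly, so dominated convergence carries the identity over to
  the limit.
\<close>

section \<open>A smooth bump function\<close>

text \<open>The weak derivative of F is known only through integrals against smooth test functions,
  and the mollification kernel centred at x is such a function. Testing with it identifies the
  x-derivative of mollified F with mollified DF, but only at points whose ball of radius e lies
  inside the truncation set. Truncation creates jumps, so elsewhere the two may differ; this is
  harmless because the test function and its gradient vanish off the support. Hence the C^2 identity
  is proved for the genuine derivative, and mollified DF is substituted only on the support. The
  exponent n matches the homogeneity: J_F is a sum of products of n derivatives, and a cofactor
  times a component of V(F) is a determinant with one row replaced, so again n factors, one of them
  of linear growth in F. The single estimate \<open>abs_det_le\<close> therefore serves both
  integrands. Tonelli and translation invariance are applied to Borel functions under
  \<open>lborel\<close>, whereas F and DF are only Lebesgue measurable, so the truncations are also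
  replaced by Borel representatives.\<close>

definition flat_exp :: "nat \<Rightarrow> real \<Rightarrow> real" where
  "flat_exp m t = (if t > 0 then (1 / t) ^ m * exp (- 1 / t) else 0)"

lemma flat_nonneg: "flat_exp m t \<ge> 0"
  by (simp add: flat_exp_def)

lemma flat_tendsto_0_right: "(flat_exp m \<longlongrightarrow> 0) (at_right 0)"
proof -
  have "((\<lambda>t. inverse t ^ m / exp (inverse t)) \<longlongrightarrow> (0::real)) (at_right 0)"
    by (rule filterlim_compose[OF tendsto_power_div_exp_0 filterlim_inverse_at_top_right])
  moreover have "eventually (\<lambda>t. inverse t ^ m / exp (inverse t) = flat_exp m t) (at_right 0)"
    by (auto simp: eventually_at_right_field flat_exp_def exp_minus field_simps intro!: exI[of _ 1])
  ultimately show ?thesis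
    by (rule Lim_transform_eventually)
qed

text \<open>The index m exists to make the family closed under differentiation up to linear
  combinations, so one formula serves all orders. The member \<open>flat_exp 0\<close> is the
  classical exp(-1/t).\<close>

lemma has_real_derivative_flat:
  "(flat_exp m has_real_derivative (flat_exp (m + 2) t - real m * flat_exp (m + 1) t)) (at t)"
proof -
  consider "t < 0" | "t = 0" | "t > 0" by linarith
  then show ?thesis
  proof cases
    case 1
    then have "((\<lambda>_. 0) has_real_derivative (flat_exp (m + 2) t - real m * flat_exp (m + 1) t)) (at t)"
      by (auto simp: flat_exp_def)
    then show ?thesis
      by (rule has_field_derivative_transform_within_open[of _ _ _ "{..<0}"])
        (use 1 in \<open>auto simp: flat_exp_def\<close>)
  next
    case 2
    \<comment> \<open>For h > 0 the difference quotient at 0 is \<open>flat_exp (Suc m) h\<close>: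
      dividing by h only raises the index.\<close>
    have "((\<lambda>h. flat_exp m h / h) \<longlongrightarrow> 0) (at_right 0)"
      by (rule Lim_transform_eventually[OF flat_tendsto_0_right[of "Suc m"]])
        (auto simp: eventually_at_right_field flat_exp_def intro!: exI[of _ 1])
    moreover have "((\<lambda>h. flat_exp m h / h) \<longlongrightarrow> 0) (at_left 0)"
      by (rule Lim_transform_eventually[OF tendsto_const[of 0]])
        (auto simp: eventually_at_left_field flat_exp_def intro!: exI[of _ "-1"])
    ultimately have "((\<lambda>h. flat_exp m h / h) \<longlongrightarrow> 0) (at 0)"
      by (simp add: filterlim_split_at)
    with 2 show ?thesis
      by (simp add: DERIV_def flat_exp_def)
  next
    case 3
    let ?s = "inverse t"
    have "((\<lambda>s. s ^ m * exp (- s)) has_real_derivative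
        (real m * ?s ^ (m - 1) * exp (- ?s) - ?s ^ m * exp (- ?s))) (at ?s)"
      by (auto intro!: derivative_eq_intros)
    moreover have "(inverse has_real_derivative - (?s\<^sup>2)) (at t)"
      using 3 by (auto intro!: derivative_eq_intros simp: power2_eq_square)
    ultimately have "((\<lambda>t. inverse t ^ m * exp (- inverse t)) has_real_derivative
        (real m * ?s ^ (m - 1) * exp (- ?s) - ?s ^ m * exp (- ?s)) * - (?s\<^sup>2)) (at t)"
      by (rule DERIV_chain2)
    moreover have "(real m * ?s ^ (m - 1) * exp (- ?s) - ?s ^ m * exp (- ?s)) * - (?s\<^sup>2)
        = flat_exp (m + 2) t - real m * flat_exp (m + 1) t"
      using 3 by (cases m) (auto simp: flat_exp_def divide_inverse algebra_simps power2_eq_square)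
    ultimately have "((\<lambda>t. inverse t ^ m * exp (- inverse t)) has_real_derivative
        flat_exp (m + 2) t - real m * flat_exp (m + 1) t) (at t)"
      by simp
    then show ?thesis
      by (rule has_field_derivative_transform_within_open[of _ _ _ "{0<..}"])
        (use 3 in \<open>auto simp: flat_exp_def divide_inverse\<close>)
  qed
qed

lemma has_derivative_flat[derivative_intros]:
  fixes g :: "real^'n \<Rightarrow> real"
  assumes "(g has_derivative g') (at x within S)"
  shows "((\<lambda>x. flat_exp m (g x)) has_derivative
    (\<lambda>h. (flat_exp (m + 2) (g x) - real m * flat_exp (m + 1) (g x)) * g' h)) (at x within S)"
  using has_derivative_compose[OF assms has_real_derivative_flat[THEN has_field_derivative_imp_has_derivative]]
  by simp

lemma continuous_on_flat[continuous_intros]: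
  "continuous_on S g \<Longrightarrow> continuous_on S (\<lambda>x. flat_exp m (g x))"
  by (rule continuous_on_compose2[of UNIV "flat_exp m"])
    (auto intro!: DERIV_isCont continuous_at_imp_continuous_on has_real_derivative_flat)

text \<open>An algebra of functions that is closed under partial derivatives, so its members are smooth.\<close>

inductive bump_algebra :: "real \<Rightarrow> real^'n \<Rightarrow> (real^'n \<Rightarrow> real) \<Rightarrow> bool" for e a where
  flat: "bump_algebra e a (\<lambda>y. flat_exp m (e\<^sup>2 - (y - a) \<bullet> (y - a)))"
| const: "bump_algebra e a (\<lambda>_. c)"
| coord: "bump_algebra e a (\<lambda>y. y $ i)"
| add: "bump_algebra e a f \<Longrightarrow> bump_algebra e a g \<Longrightarrow> bump_algebra e a (\<lambda>y. f y + g y)"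
| mult: "bump_algebra e a f \<Longrightarrow> bump_algebra e a g \<Longrightarrow> bump_algebra e a (\<lambda>y. f y * g y)"

lemma partial_deriv_eqI:
  "(f has_derivative f') (at x) \<Longrightarrow> f' (axis j 1) = d \<Longrightarrow> partial_deriv j f x = d"
  unfolding partial_deriv_def by (metis frechet_derivative_at)

lemma bump_algebra_derivative:
  fixes f :: "real^'n \<Rightarrow> real"
  assumes "bump_algebra e a f"
  shows "(\<forall>x. f differentiable (at x)) \<and> bump_algebra e a (partial_deriv j f)"
  using assms
proof induction
  case (flat m)
  let ?s = "\<lambda>y. e\<^sup>2 - (y - a) \<bullet> (y - a)"
  \<comment> \<open>Differences are written as sums with negated constants, so that the term is
    literally built from the introduction rules of the algebra.\<close>
  let ?d = "\<lambda>y. (flat_exp (m + 2) (?s y) + (- real m) * flat_exp (m + 1) (?s y)) * ((- 2) * (y $ j + - (a $ j)))"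
  have der: "((\<lambda>y. flat_exp m (?s y)) has_derivative
      (\<lambda>h. (flat_exp (m + 2) (?s y) - real m * flat_exp (m + 1) (?s y)) * (- 2 * ((y - a) \<bullet> h)))) (at y)" for y
    by (auto intro!: derivative_eq_intros simp: inner_commute algebra_simps)
  have "partial_deriv j (\<lambda>y. flat_exp m (?s y)) = ?d"
    by (rule ext, rule partial_deriv_eqI[OF der]) (simp add: inner_axis)
  moreover have "bump_algebra e a ?d"
    by (intro bump_algebra.intros)
  ultimately show ?case
    using der by (auto simp: differentiable_def)
next
  case (const c)
  have "partial_deriv j (\<lambda>_. c) = (\<lambda>_. 0)"
    by (rule ext, rule partial_deriv_eqI[OF has_derivative_const]) simp
  then show ?case by (simp add: bump_algebra.const)
next
  case (coord i)
  have der: "((\<lambda>y. y $ i) has_derivative (\<lambda>h. h $ i)) (at y)" for y :: "real^'n"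
    by (rule bounded_linear_imp_has_derivative[OF bounded_linear_vec_nth])
  have "partial_deriv j (\<lambda>y. y $ i) = (\<lambda>_. axis j 1 $ i)"
    by (rule ext, rule partial_deriv_eqI[OF der]) simp
  with der show ?case by (auto simp: bump_algebra.const differentiable_def)
next
  case (add f g)
  then have d: "(f has_derivative frechet_derivative f (at x)) (at x)"
    "(g has_derivative frechet_derivative g (at x)) (at x)" for x
    by (auto simp: frechet_derivative_works)
  have "partial_deriv j (\<lambda>y. f y + g y) = (\<lambda>y. partial_deriv j f y + partial_deriv j g y)"
    by (rule ext, rule partial_deriv_eqI[OF has_derivative_add[OF d]]) (simp add: partial_deriv_def)
  with add show ?case by (auto intro: bump_algebra.intros)
next
  case (mult f g)
  then have d: "(f has_derivative frechet_derivative f (at x)) (at x)"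
    "(g has_derivative frechet_derivative g (at x)) (at x)" for x
    by (auto simp: frechet_derivative_works)
  have "partial_deriv j (\<lambda>y. f y * g y) = (\<lambda>y. f y * partial_deriv j g y + partial_deriv j f y * g y)"
    by (rule ext, rule partial_deriv_eqI[OF has_derivative_mult[OF d]]) (simp add: partial_deriv_def)
  with mult show ?case by (auto intro: bump_algebra.intros)
qed

lemma smooth_fun_bump_algebra:
  fixes f :: "real^'n \<Rightarrow> real"
  assumes "bump_algebra e a f"
  shows "smooth_fun f"
proof -
  have "f \<in> Ck_fun k" for k
    using assms
  proof (induction k arbitrary: f)
    case 0
    then show ?case
      using bump_algebra_derivative[OF 0]
      by (auto intro!: continuous_at_imp_continuous_on differentiable_imp_continuous_within)
  next
    case (Suc k)
    then show ?case using bump_algebra_derivative[OF Suc.prems] by auto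
  qed
  then show ?thesis by (simp add: smooth_fun_def)
qed

definition bump :: "real \<Rightarrow> real^'n \<Rightarrow> real" where
  "bump e z = flat_exp 0 (e\<^sup>2 - z \<bullet> z)"

text \<open>The first partial derivatives of \<open>bump e\<close>, with the second ones in
  \<open>bump2\<close>. The inner function e^2 - z.z has j-th partial -2 z_j,
  \<open>flat_exp 0\<close> differentiates to \<open>flat_exp 2\<close>, and that to
  \<open>flat_exp 4\<close> minus twice \<open>flat_exp 3\<close>. The closed forms make continuity,
  support and symmetry in the two indices visible.\<close>

definition bump1 :: "real \<Rightarrow> 'n \<Rightarrow> real^'n \<Rightarrow> real" where
  "bump1 e j z = - 2 * z $ j * flat_exp 2 (e\<^sup>2 - z \<bullet> z)"

definition bump2 :: "real \<Rightarrow> 'n \<Rightarrow> 'n \<Rightarrow> real^'n \<Rightarrow> real" where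
  "bump2 e j l z = 4 * z $ j * z $ l * (flat_exp 4 (e\<^sup>2 - z \<bullet> z) - 2 * flat_exp 3 (e\<^sup>2 - z \<bullet> z))
     - (if j = l then 2 * flat_exp 2 (e\<^sup>2 - z \<bullet> z) else 0)"

lemma bump2_commute: "bump2 e j l z = bump2 e l j z"
  by (simp add: bump2_def)

lemma flat_outside: "0 < e \<Longrightarrow> z \<notin> cball 0 e \<Longrightarrow> flat_exp m (e\<^sup>2 - z \<bullet> z) = 0" for z :: "real^'n"
  by (auto simp: flat_exp_def dot_square_norm abs_le_square_iff[symmetric] not_less)

lemma bump_outside:
  assumes "0 < e" "z \<notin> cball 0 e"
  shows "bump e z = 0" "bump1 e j z = 0" "bump2 e j l z = 0"
  using flat_outside[OF assms] by (auto simp: bump_def bump1_def bump2_def)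

lemma continuous_bump:
  "continuous_on UNIV (bump e)" "continuous_on UNIV (bump1 e j)" "continuous_on UNIV (bump2 e j l)"
  unfolding bump_def[abs_def] bump1_def[abs_def] bump2_def[abs_def]
  by (cases "j = l"; intro continuous_intros; simp)+

lemma has_derivative_bump:
  "(bump e has_derivative (\<lambda>h. \<Sum>l\<in>UNIV. bump1 e l z * h $ l)) (at z)"
  unfolding bump_def[abs_def] bump1_def
  by (rule derivative_eq_intros refl)+
    (auto simp: inner_vec_def sum_distrib_left sum_distrib_right sum_negf[symmetric] algebra_simps numeral_2_eq_2 sum.distrib[symmetric])

lemma has_derivative_bump1:
  "(bump1 e j has_derivative (\<lambda>h. \<Sum>l\<in>UNIV. bump2 e j l z * h $ l)) (at z)"
proof -
  let ?s = "e\<^sup>2 - z \<bullet> z"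
  have "(bump1 e j has_derivative
      (\<lambda>h. - 2 * z $ j * ((flat_exp 4 ?s - 2 * flat_exp 3 ?s) * (- 2 * (z \<bullet> h))) + - 2 * h $ j * flat_exp 2 ?s)) (at z)"
    unfolding bump1_def[abs_def]
    by (rule derivative_eq_intros bounded_linear_imp_has_derivative[OF bounded_linear_vec_nth] refl)+
      (auto simp: inner_commute algebra_simps eval_nat_numeral)
  moreover have "- 2 * z $ j * ((flat_exp 4 ?s - 2 * flat_exp 3 ?s) * (- 2 * (z \<bullet> h))) + - 2 * h $ j * flat_exp 2 ?s
      = (\<Sum>l\<in>UNIV. bump2 e j l z * h $ l)" for h
  proof -
    have "(\<Sum>l\<in>UNIV. bump2 e j l z * h $ l) =
        (\<Sum>l\<in>UNIV. 4 * z $ j * (flat_exp 4 ?s - 2 * flat_exp 3 ?s) * (z $ l * h $ l)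
          - (if j = l then 2 * flat_exp 2 ?s * h $ l else 0))"
      by (rule sum.cong) (auto simp: bump2_def algebra_simps)
    then show ?thesis
      by (simp add: sum_subtractf sum_distrib_left[symmetric] inner_vec_def)
  qed
  ultimately show ?thesis by simp
qed

text \<open>The purpose of the bump algebra: \<open>weak_jacobian\<close> speaks only about test
  functions with derivatives of all orders, and the mollification kernel has to be one. The closed
  ball is required inside \<Omega> because it is what contains the closure of the set where the
  kernel is nonzero.\<close>

lemma test_fun_bump:
  assumes "0 < e" "cball x e \<subseteq> \<Omega>"
  shows "test_fun \<Omega> (\<lambda>y. bump e (y - x))"
proof -
  have "smooth_fun (\<lambda>y. bump e (y - x))"
    unfolding bump_def by (rule smooth_fun_bump_algebra) (rule bump_algebra.flat)
  moreover have "closure {y. bump e (y - x) \<noteq> 0} \<subseteq> cball x e"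
    using bump_outside(1)[OF assms(1)] by (intro closure_minimal) (force simp: dist_norm norm_minus_commute)+
  moreover from this have "compact (closure {y. bump e (y - x) \<noteq> 0})"
    by (meson bounded_cball bounded_subset closed_closure compact_eq_bounded_closed)
  ultimately show ?thesis
    using assms(2) by (auto simp: test_fun_def)
qed

lemma partial_deriv_bump: "partial_deriv j (\<lambda>y. bump e (y - x)) y = bump1 e j (y - x)"
proof (rule partial_deriv_eqI)
  have "((\<lambda>y. y - x) has_derivative (\<lambda>h. h)) (at y)"
    by (auto intro!: derivative_eq_intros)
  from has_derivative_compose[OF this has_derivative_bump]
  show "((\<lambda>y. bump e (y - x)) has_derivative (\<lambda>h. \<Sum>l\<in>UNIV. bump1 e l (y - x) * h $ l)) (at y)" .
qed (simp add: axis_def if_distrib cong: if_cong)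

section \<open>The identity for maps of class $C^2$\<close>

lemma integral_lborel_translate:
  fixes f :: "'a::euclidean_space \<Rightarrow> real"
  assumes "f \<in> borel_measurable borel"
  shows "(\<integral>x. f (c + x) \<partial>lborel) = (\<integral>x. f x \<partial>lborel)"
  using integral_distr[of "(+) c" lborel borel f] assms by (simp add: lborel_distr_plus)

lemma integrable_lborel_translate:
  fixes f :: "'a::euclidean_space \<Rightarrow> real"
  assumes "integrable lborel f"
  shows "integrable lborel (\<lambda>x. f (c + x))"
  using integrable_distr_eq[of "(+) c" lborel borel f] assms
  by (simp add: lborel_distr_plus borel_measurable_integrable[of lborel f, simplified])

lemma integrable_compact_support:
  fixes f :: "'a::euclidean_space \<Rightarrow> real"
  assumes "continuous_on UNIV f" "compact K" "\<And>x. x \<notin> K \<Longrightarrow> f x = 0"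
  shows "integrable lborel f"
proof -
  have "integrable lborel (\<lambda>x. indicator K x *\<^sub>R f x)"
    by (rule borel_integrable_compact[OF assms(2) continuous_on_subset[OF assms(1)]]) simp
  moreover have "(\<lambda>x. indicator K x *\<^sub>R f x) = f"
    using assms(3) by (auto simp: fun_eq_iff indicator_def)
  ultimately show ?thesis by simp
qed

lemma bounded_compact_support:
  fixes f :: "'a::euclidean_space \<Rightarrow> real"
  assumes "continuous_on UNIV f" "compact K" "\<And>x. x \<notin> K \<Longrightarrow> f x = 0"
  obtains M where "0 \<le> M" "\<And>x. \<bar>f x\<bar> \<le> M"
proof -
  have "bounded (f ` K)"
    by (intro compact_imp_bounded compact_continuous_image continuous_on_subset[OF assms(1)] assms) simp
  then obtain M where M: "\<And>x. x \<in> K \<Longrightarrow> \<bar>f x\<bar> \<le> M"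
    by (auto simp: bounded_iff)
  have "\<bar>f x\<bar> \<le> \<bar>M\<bar>" for x
    using M[of x] assms(3)[of x] by (cases "x \<in> K") auto
  then show thesis using that[of "\<bar>M\<bar>"] by simp
qed

lemma has_derivative_zero_outside:
  fixes g :: "'a::euclidean_space \<Rightarrow> real"
  assumes "(g has_derivative g') (at x)" "closed K" "\<And>x. x \<notin> K \<Longrightarrow> g x = 0" "x \<notin> K"
  shows "g' = (\<lambda>_. 0)"
proof -
  have "((\<lambda>_. 0) has_derivative g') (at x)"
    by (rule has_derivative_transform_within_open[OF assms(1), of "- K"]) (use assms in auto)
  then show ?thesis
    using has_derivative_unique has_derivative_const by blast
qed

text \<open>Translation invariance makes the integral of every difference quotient vanish.\<close>
lemma integral_directional_derivative:
  fixes g :: "'a::euclidean_space \<Rightarrow> real"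
  assumes der: "\<And>x. (g has_derivative g' x) (at x)"
    and cont: "continuous_on UNIV (\<lambda>x. g' x v)"
    and K: "compact K" "\<And>x. x \<notin> K \<Longrightarrow> g x = 0"
  shows "(\<integral>x. g' x v \<partial>lborel) = 0"
proof -
  define t where "t n = inverse (real (Suc n))" for n
  have t: "0 < t n" "t n \<le> 1" for n
    by (auto simp: t_def inverse_le_1_iff)
  have tlim: "t \<longlonglongrightarrow> 0"
    unfolding t_def by (rule LIMSEQ_inverse_real_of_nat)
  have g'0: "g' x v = 0" if "x \<notin> K" for x
    using has_derivative_zero_outside[OF der compact_imp_closed[OF K(1)] K(2) that] by simp
  obtain M where M: "0 \<le> M" "\<And>x. \<bar>g' x v\<bar> \<le> M"
    using bounded_compact_support[OF cont K(1) g'0] by blast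
  have contg: "continuous_on UNIV g"
    using der by (auto intro!: continuous_at_imp_continuous_on has_derivative_continuous)
  then have [measurable]: "g \<in> borel_measurable borel"
    by (rule borel_measurable_continuous_onI)
  have [measurable]: "(\<lambda>x. g' x v) \<in> borel_measurable borel"
    using cont by (rule borel_measurable_continuous_onI)
  have int: "integrable lborel g"
    by (rule integrable_compact_support[OF contg K])
  define q where "q n x = (g (t n *\<^sub>R v + x) - g x) / t n" for n x
  have [measurable]: "q n \<in> borel_measurable borel" for n
    unfolding q_def[abs_def] by measurable
  have q0: "(\<integral>x. q n x \<partial>lborel) = 0" for n
    unfolding q_def
    by (simp add: Bochner_Integration.integral_diff[OF integrable_lborel_translate[OF int] int]
        integral_lborel_translate)
  \<comment> \<open>K swept along the segment from 0 to -v. A point moved into K by some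
    \<open>s *\<^sub>R v\<close> with 0 \<le> s \<le> 1 lies in L, so all quotients vanish outside
    this one compact set.\<close>
  define L where "L = {x + y | x y. x \<in> K \<and> y \<in> (\<lambda>s. s *\<^sub>R (- v)) ` {0..1}}"
  have "compact L"
    unfolding L_def by (intro compact_sums K compact_continuous_image continuous_intros compact_Icc)
  have mem: "x \<in> L" if "s *\<^sub>R v + x \<in> K" "0 \<le> s" "s \<le> 1" for s x
    unfolding L_def using that
    by (intro CollectI exI[of _ "s *\<^sub>R v + x"] exI[of _ "s *\<^sub>R (- v)"]) auto
  have bound: "\<bar>q n x\<bar> \<le> indicator L x * M" for n x
  proof (cases "x \<in> L")
    case True
    have d: "((\<lambda>s. g (s *\<^sub>R v + x)) has_real_derivative g' (s *\<^sub>R v + x) v) (at s)" for s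
    proof -
      have "((\<lambda>s. s *\<^sub>R v + x) has_derivative (\<lambda>h. h *\<^sub>R v)) (at s)"
        by (auto intro!: derivative_eq_intros)
      from has_derivative_compose[OF this der]
      have "((\<lambda>s. g (s *\<^sub>R v + x)) has_derivative (\<lambda>h. g' (s *\<^sub>R v + x) (h *\<^sub>R v))) (at s)" .
      then show ?thesis
        by (simp add: has_field_derivative_def linear_scale[OF has_derivative_linear[OF der]] mult_commute_abs)
    qed
    \<comment> \<open>The mean value theorem turns the quotient into a value of the directional
      derivative, which is at most M uniformly in n.\<close>
    obtain z where "g (t n *\<^sub>R v + x) - g (0 *\<^sub>R v + x) = (t n - 0) * g' (z *\<^sub>R v + x) v"
      using MVT2[OF t(1)[of n], of "\<lambda>s. g (s *\<^sub>R v + x)" "\<lambda>s. g' (s *\<^sub>R v + x) v"] d by blast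
    then have "q n x = g' (z *\<^sub>R v + x) v"
      using t(1)[of n] by (simp add: q_def)
    then show ?thesis
      using M(2) True by simp
  next
    case False
    then have "t n *\<^sub>R v + x \<notin> K" "0 *\<^sub>R v + x \<notin> K"
      using mem[of "t n" x] mem[of 0 x] t[of n] by auto
    then show ?thesis
      using K(2) False by (simp add: q_def)
  qed
  have lim: "(\<lambda>n. q n x) \<longlonglongrightarrow> g' x v" for x
  proof -
    have "((\<lambda>s. x + s *\<^sub>R v) has_derivative (\<lambda>h. h *\<^sub>R v)) (at 0)"
      by (auto intro!: derivative_eq_intros)
    from has_derivative_compose[OF this, of g "g' x"] der
    have "((\<lambda>s. g (x + s *\<^sub>R v)) has_derivative (\<lambda>h. g' x (h *\<^sub>R v))) (at 0)"
      by simp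
    then have "((\<lambda>s. g (x + s *\<^sub>R v)) has_real_derivative g' x v) (at 0)"
      by (simp add: has_field_derivative_def linear_scale[OF has_derivative_linear[OF der]] mult_commute_abs)
    then have "((\<lambda>s. (g (x + s *\<^sub>R v) - g x) / s) \<longlongrightarrow> g' x v) (at 0)"
      by (simp add: DERIV_def)
    then have "(\<lambda>n. (g (x + t n *\<^sub>R v) - g x) / t n) \<longlonglongrightarrow> g' x v"
      by (rule filterlim_compose) (use tlim t(1) in \<open>auto simp: filterlim_at less_le intro!: always_eventually\<close>)
    then show ?thesis by (simp add: q_def add.commute)
  qed
  have "(\<lambda>n. \<integral>x. q n x \<partial>lborel) \<longlonglongrightarrow> (\<integral>x. g' x v \<partial>lborel)"
  proof (rule integral_dominated_convergence[where w="\<lambda>x. indicator L x * M"])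
    show "integrable lborel (\<lambda>x. indicator L x * M)"
      using borel_integrable_compact[OF \<open>compact L\<close>, of "\<lambda>_. M"] by simp
  qed (use lim bound in auto)
  then show ?thesis by (simp add: q0 LIMSEQ_const_iff)
qed

section \<open>Determinants, cofactors and the Piola identity\<close>

lemma has_derivative_det:
  fixes A :: "'a::real_normed_vector \<Rightarrow> real^'n^'n"
  assumes "\<And>i j. ((\<lambda>x. A x $ i $ j) has_derivative (\<lambda>h. A' h $ i $ j)) (at x)"
  shows "((\<lambda>x. det (A x)) has_derivative
    (\<lambda>h. \<Sum>k\<in>UNIV. det (\<chi> r. if r = k then A' h $ r else A x $ r))) (at x)"
proof -
  have "((\<lambda>x. det (A x)) has_derivative
    (\<lambda>h. \<Sum>p | p permutes UNIV. of_int (sign p) *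
      (\<Sum>k\<in>UNIV. A' h $ k $ p k * (\<Prod>r\<in>UNIV - {k}. A x $ r $ p r)))) (at x)"
    unfolding det_def
    by (intro has_derivative_sum has_derivative_mult_right has_derivative_prod assms)
  moreover have "(\<Sum>p | p permutes UNIV. of_int (sign p) *
      (\<Sum>k\<in>UNIV. A' h $ k $ p k * (\<Prod>r\<in>UNIV - {k}. A x $ r $ p r)))
    = (\<Sum>k\<in>UNIV. det (\<chi> r. if r = k then A' h $ r else A x $ r))" for h
  proof -
    \<comment> \<open>In each Leibniz term the differentiated factor is put back into the product as
      an entry of a replaced row k; exchanging the two sums then shows one determinant for each
      k.\<close>
    have "A' h $ k $ p k * (\<Prod>r\<in>UNIV - {k}. A x $ r $ p r)
        = (\<Prod>r\<in>UNIV. (\<chi> r. if r = k then A' h $ r else A x $ r) $ r $ p r)" for k p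
      by (subst prod.remove[of UNIV k]) (auto intro!: prod.cong)
    then show ?thesis
      unfolding det_def by (simp add: sum_distrib_left) (rule sum.swap)
  qed
  ultimately show ?thesis by simp
qed

lemma continuous_on_det:
  fixes A :: "'a::topological_space \<Rightarrow> real^'n^'n"
  assumes "\<And>i j. continuous_on S (\<lambda>x. A x $ i $ j)"
  shows "continuous_on S (\<lambda>x. det (A x))"
  unfolding det_def by (intro continuous_intros assms)

text \<open>Linearity of \<open>det\<close> in row k, with c written in the standard basis. This is
  the Laplace expansion, its cofactors being determinants with a basis vector in row k; it yields
  both the adjugate relation and the expansion inside the Piola identity.\<close>

lemma det_row_expand:
  fixes c :: "real^'n" and B :: "'n \<Rightarrow> real^'n"
  shows "(\<Sum>i\<in>UNIV. c $ i * det (\<chi> r. if r = k then axis i 1 else B r)) = det (\<chi> r. if r = k then c else B r)"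
proof -
  have "det (\<chi> r. if r = k then c else B r) = det (\<chi> r. if r = k then (\<Sum>i\<in>UNIV. c $ i *s axis i 1) else B r)"
    by (simp only: basis_expansion)
  also have "\<dots> = (\<Sum>i\<in>UNIV. det (\<chi> r. if r = k then c $ i *s axis i 1 else B r))"
    using det_linear_row_sum[of UNIV k "\<lambda>_ i. c $ i *s axis i 1" B] by simp
  also have "\<dots> = (\<Sum>i\<in>UNIV. c $ i * det (\<chi> r. if r = k then axis i 1 else B r))"
    by (simp add: det_row_mul)
  finally show ?thesis by simp
qed

lemma adj_nth: "adj A $ i $ j = det (\<chi> r. if r = j then axis i 1 else A $ r)"
  unfolding adj_def by (auto intro!: arg_cong[where f=det] simp: vec_eq_iff axis_def)

text \<open>The sum expands the determinant of A with row j replaced by row k. For k = j this is A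
  again; otherwise two rows coincide.\<close>

lemma mult_adj: "(\<Sum>i\<in>UNIV. A $ k $ i * adj A $ i $ j) = (if k = j then det A else 0)"
proof -
  have "(\<Sum>i\<in>UNIV. A $ k $ i * adj A $ i $ j) = det (\<chi> r. if r = j then A $ k else A $ r)"
    unfolding adj_nth by (rule det_row_expand)
  also have "\<dots> = (if k = j then det A else 0)"
  proof (cases "k = j")
    case True
    then have "(\<chi> r. if r = j then A $ k else A $ r) = A" by (auto simp: vec_eq_iff)
    with True show ?thesis by simp
  next
    case False
    then show ?thesis
      by (auto intro!: det_identical_rows[of k j] simp: row_def vec_eq_iff)
  qed
  finally show ?thesis .
qed

lemma det_swap_axis_rows:
  fixes B :: "'n \<Rightarrow> real^'n"
  assumes "k \<noteq> j"
  shows "det (\<chi> r. if r = k then axis l 1 else if r = j then axis i 1 else B r)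
    = - det (\<chi> r. if r = k then axis i 1 else if r = j then axis l 1 else B r)"
proof -
  let ?M = "\<chi> r. if r = k then axis i 1 else if r = j then axis l 1 else B r"
  have "(\<chi> r. if r = k then axis l 1 else if r = j then axis i 1 else B r) = (\<chi> r. ?M $ Transposition.transpose k j r)"
    using assms by (auto simp: vec_eq_iff Transposition.transpose_def)
  then show ?thesis
    using det_permute_rows[OF permutes_swap_id[of k UNIV j], of ?M] assms
    by (simp add: sign_swap_id)
qed

text \<open>The Piola identity: second derivatives are symmetric while minors are alternating.\<close>
lemma divergence_adj:
  fixes A :: "real^'n^'n" and H :: "'n \<Rightarrow> 'n \<Rightarrow> 'n \<Rightarrow> real"
  assumes sym: "\<And>r i l. H r i l = H r l i"
  shows "(\<Sum>i\<in>UNIV. \<Sum>k\<in>UNIV. det (\<chi> r. if r = k then (if r = j then 0 else (\<chi> l. H r l i))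
      else if r = j then axis i 1 else A $ r)) = 0"
proof -
  have "(\<Sum>i\<in>UNIV. det (\<chi> r. if r = k then (if r = j then 0 else (\<chi> l. H r l i))
      else if r = j then axis i 1 else A $ r)) = 0" for k
  proof (cases "k = j")
    case True
    \<comment> \<open>Row j is the constant vector \<open>axis i 1\<close>, so differentiating it
      contributes a zero row.\<close>
    have "det (\<chi> r. if r = j then 0 else if r = j then axis i 1 else A $ r) = 0" for i
      by (rule det_row_0)
    then show ?thesis using True by (auto cong: if_cong)
  next
    case False
    \<comment> \<open>Expanding along row k leaves determinants with unit vectors in rows k and j;
      exchanging these two rows exchanges l and i.\<close>
    define B where "B i l = det (\<chi> r. if r = k then axis l 1 else if r = j then axis i 1 else A $ r)" for i l
    have anti: "B i l = - B l i" for i l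
      unfolding B_def by (rule det_swap_axis_rows[OF False])
    have "det (\<chi> r. if r = k then (if r = j then 0 else (\<chi> l. H r l i)) else if r = j then axis i 1 else A $ r)
       = (\<Sum>l\<in>UNIV. H k l i * B i l)" for i
    proof -
      have "(\<Sum>l\<in>UNIV. (\<chi> l. H k l i) $ l * B i l)
        = det (\<chi> r. if r = k then (\<chi> l. H k l i) else if r = j then axis i 1 else A $ r)"
        unfolding B_def by (rule det_row_expand)
      moreover have "(\<chi> r. if r = k then (if r = j then 0 else (\<chi> l. H r l i)) else if r = j then axis i 1 else A $ r)
        = (\<chi> r. if r = k then (\<chi> l. H k l i) else if r = j then axis i 1 else A $ r)"
        using False by (auto simp: vec_eq_iff)
      ultimately show ?thesis by simp
    qed
    moreover have "(\<Sum>i\<in>UNIV. \<Sum>l\<in>UNIV. H k l i * B i l) = - (\<Sum>i\<in>UNIV. \<Sum>l\<in>UNIV. H k l i * B i l)"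
    proof -
      have "(\<Sum>i\<in>UNIV. \<Sum>l\<in>UNIV. H k l i * B i l) = (\<Sum>i\<in>UNIV. \<Sum>l\<in>UNIV. - (H k i l * B l i))"
        by (intro sum.cong refl) (use anti sym in \<open>metis mult_minus_right\<close>)
      also have "\<dots> = - (\<Sum>l\<in>UNIV. \<Sum>i\<in>UNIV. H k i l * B l i)"
        by (subst sum.swap) (simp add: sum_negf)
      finally show ?thesis .
    qed
    ultimately show ?thesis by simp
  qed
  then show ?thesis by (subst sum.swap) simp
qed

text \<open>Every term \<partial>_i (adj(A)_ij V_j(W) \<phi>) integrates to zero, and the terms are
  summed over i and j. Derivatives of the cofactors cancel by Piola, those of V(W) collapse to the
  trace of DV times det A by \<open>mult_adj\<close>, and those of \<phi> give the flux. The first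
  and second derivatives A and H of W are parameters because for mollifications they come as
  explicit integrals.\<close>

lemma C2_divergence_identity:
  fixes W :: "real^'n \<Rightarrow> real^'n" and A :: "real^'n \<Rightarrow> real^'n^'n"
    and V :: "real^'n \<Rightarrow> real^'n" and DV :: "real^'n \<Rightarrow> real^'n^'n"
  assumes W: "\<And>x. (W has_derivative (\<lambda>h. A x *v h)) (at x)"
    and A: "\<And>x i j. ((\<lambda>x. A x $ i $ j) has_derivative (\<lambda>h. \<Sum>l\<in>UNIV. H x i j l * h $ l)) (at x)"
    and Hcont: "\<And>i j l. continuous_on UNIV (\<lambda>x. H x i j l)"
    and Hsym: "\<And>x i j l. H x i j l = H x i l j"
    and V: "\<And>y. (V has_derivative (\<lambda>h. DV y *v h)) (at y)"
    and DV: "continuous_on UNIV DV"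
    and \<phi>: "\<And>x. (\<phi> has_derivative (\<lambda>h. g x \<bullet> h)) (at x)"
    and g: "continuous_on UNIV g"
    and K: "compact K" "\<And>x. x \<notin> K \<Longrightarrow> \<phi> x = 0"
  shows "(\<integral>x. (adj (A x) *v V (W x)) \<bullet> g x \<partial>lborel) = - (\<integral>x. mtrace (DV (W x)) * det (A x) * \<phi> x \<partial>lborel)"
proof -
  \<comment> \<open>\<open>d i j\<close> is the i-th partial derivative of
    \<open>adj (A x) $ i $ j\<close>, and \<open>w' j x\<close> below is the derivative of
    \<open>w j\<close> at x.\<close>
  define d where "d i j x = (\<Sum>k\<in>UNIV. det (\<chi> r. if r = k then (if r = j then 0 else (\<chi> l. H x r l i))
      else if r = j then axis i 1 else A x $ r))" for i j x
  define w where "w j x = V (W x) $ j * \<phi> x" for j x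
  define w' where "w' j x h = (DV (W x) *v (A x *v h)) $ j * \<phi> x + V (W x) $ j * (g x \<bullet> h)" for j x h
  have contW: "continuous_on UNIV W" and contV: "continuous_on UNIV V" and cont\<phi>: "continuous_on UNIV \<phi>"
    using W V \<phi> by (auto intro!: continuous_at_imp_continuous_on intro: has_derivative_continuous)
  have contA: "continuous_on UNIV (\<lambda>x. A x $ i $ j)" for i j
    using A by (auto intro!: continuous_at_imp_continuous_on intro: has_derivative_continuous)
  have contVW: "continuous_on UNIV (\<lambda>x. V (W x) $ j)" for j
    by (intro continuous_intros continuous_on_compose2[OF contV contW]) auto
  have contDVW: "continuous_on UNIV (\<lambda>x. DV (W x) $ i $ j)" for i j
    by (intro continuous_intros continuous_on_compose2[OF DV contW]) auto
  have contg: "continuous_on UNIV (\<lambda>x. g x $ j)" for j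
    by (intro continuous_intros g)
  have adj_der: "((\<lambda>x. adj (A x) $ i $ j) has_derivative
      (\<lambda>h. \<Sum>k\<in>UNIV. det (\<chi> r. if r = k then (if r = j then 0 else (\<chi> c. \<Sum>l\<in>UNIV. H x r c l * h $ l))
      else if r = j then axis i 1 else A x $ r))) (at x)" for i j x
  proof -
    have "((\<lambda>x. (\<chi> r. if r = j then axis i 1 else A x $ r) $ a $ b) has_derivative
       (\<lambda>h. (\<chi> r. if r = j then 0 else (\<chi> c. \<Sum>l\<in>UNIV. H x r c l * h $ l)) $ a $ b)) (at x)" for a b
      using A by (cases "a = j") auto
    from has_derivative_det[of "\<lambda>x. (\<chi> r. if r = j then axis i 1 else A x $ r)", OF this]
    show ?thesis by (simp add: adj_nth cong: if_cong)
  qed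
  have contadj: "continuous_on UNIV (\<lambda>x. adj (A x) $ i $ j)" for i j
    using adj_der[THEN has_derivative_continuous] by (auto intro!: continuous_at_imp_continuous_on)
  have contd: "continuous_on UNIV (d i j)" for i j
    unfolding d_def
  proof (intro continuous_on_sum continuous_on_det)
    fix k a b
    show "continuous_on UNIV (\<lambda>x. (\<chi> r. if r = k then (if r = j then 0 else (\<chi> l. H x r l i))
      else if r = j then axis i 1 else A x $ r) $ a $ b)"
      using Hcont contA by (cases "a = k"; cases "a = j") auto
  qed
  have w_der: "(w j has_derivative w' j x) (at x)" for j x
  proof -
    have "((\<lambda>x. V (W x) $ j) has_derivative (\<lambda>h. (DV (W x) *v (A x *v h)) $ j)) (at x)"
      by (rule bounded_linear.has_derivative[OF bounded_linear_vec_nth has_derivative_compose[OF W V]])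
    from has_derivative_mult[OF this \<phi>]
    show ?thesis unfolding w_def[abs_def] w'_def[abs_def] by (simp add: add.commute)
  qed
  have contw: "continuous_on UNIV (w j)" for j
    unfolding w_def by (intro continuous_intros contVW cont\<phi>)
  have contw': "continuous_on UNIV (\<lambda>x. w' j x (axis i 1))" for i j
    unfolding w'_def matrix_vector_mult_def
    by (simp add: inner_axis) (intro continuous_intros contVW contDVW contA contg cont\<phi>)
  have wK: "w j x = 0" if "x \<notin> K" for j x
    using K(2)[OF that] by (simp add: w_def)
  have w'K: "w' j x h = 0" if "x \<notin> K" for j x h
    using has_derivative_zero_outside[OF w_der compact_imp_closed[OF K(1)] wK that] by simp
  \<comment> \<open>The i-th partial derivative of the product of the cofactor entry with
    \<open>w j\<close>. Its integral vanishes for each pair (i, j), before any cancellation is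
    used.\<close>
  define G where "G i j x = d i j x * w j x + adj (A x) $ i $ j * w' j x (axis i 1)" for i j x
  have axis_sum: "(\<Sum>l\<in>UNIV. c l * axis i 1 $ l) = c i" for c :: "'n \<Rightarrow> real" and i
    by (simp add: axis_def if_distrib cong: if_cong)
  have intG: "integrable lborel (G i j)" and G0: "(\<integral>x. G i j x \<partial>lborel) = 0" for i j
  proof -
    have cont: "continuous_on UNIV (G i j)"
      unfolding G_def by (intro continuous_intros contd contw contw' contadj)
    then show "integrable lborel (G i j)"
      by (rule integrable_compact_support[OF _ K(1)]) (simp add: G_def wK w'K)
    have der: "((\<lambda>x. adj (A x) $ i $ j * w j x) has_derivative
      (\<lambda>h. adj (A x) $ i $ j * w' j x h + (\<Sum>k\<in>UNIV. det (\<chi> r. if r = k then (if r = j then 0 else (\<chi> c. \<Sum>l\<in>UNIV. H x r c l * h $ l))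
      else if r = j then axis i 1 else A x $ r)) * w j x)) (at x)" (is "(_ has_derivative ?D x) _") for x
      by (rule has_derivative_mult[OF adj_der w_der])
    have D: "?D x (axis i 1) = G i j x" for x
      unfolding axis_sum G_def d_def by simp
    have "(\<integral>x. ?D x (axis i 1) \<partial>lborel) = 0"
      by (rule integral_directional_derivative[OF der _ K(1)]) (simp only: D cont, simp add: wK)
    then show "(\<integral>x. G i j x \<partial>lborel) = 0" unfolding D .
  qed
  have "(\<integral>x. (\<Sum>j\<in>UNIV. \<Sum>i\<in>UNIV. G i j x) \<partial>lborel) = 0"
    by (simp add: integral_sum intG G0)
  moreover have "(\<Sum>j\<in>UNIV. \<Sum>i\<in>UNIV. G i j x) =
      (adj (A x) *v V (W x)) \<bullet> g x + mtrace (DV (W x)) * det (A x) * \<phi> x" for x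
  proof -
    have "(\<Sum>i\<in>UNIV. d i j x * w j x) = 0" for j
      using divergence_adj[of "H x" j "A x"] Hsym unfolding d_def
      by (simp add: sum_distrib_right[symmetric])
    then have "(\<Sum>j\<in>UNIV. \<Sum>i\<in>UNIV. G i j x) = (\<Sum>j\<in>UNIV. \<Sum>i\<in>UNIV. adj (A x) $ i $ j * w' j x (axis i 1))"
      by (simp add: G_def sum.distrib)
    also have "\<dots> = (\<Sum>j\<in>UNIV. \<Sum>i\<in>UNIV. adj (A x) $ i $ j * ((\<Sum>k\<in>UNIV. DV (W x) $ j $ k * A x $ k $ i) * \<phi> x))
        + (\<Sum>j\<in>UNIV. \<Sum>i\<in>UNIV. adj (A x) $ i $ j * (V (W x) $ j * g x $ i))"
      unfolding sum.distrib[symmetric]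
      by (intro sum.cong refl) (simp add: w'_def matrix_vector_mult_def inner_axis axis_sum distrib_left)
    \<comment> \<open>Summing over i first pairs row k of A with column j of its adjugate, so only k
      = j survives.\<close>
    also have "(\<Sum>j\<in>UNIV. \<Sum>i\<in>UNIV. adj (A x) $ i $ j * ((\<Sum>k\<in>UNIV. DV (W x) $ j $ k * A x $ k $ i) * \<phi> x))
        = (\<Sum>j\<in>UNIV. DV (W x) $ j $ j * det (A x) * \<phi> x)"
    proof (rule sum.cong[OF refl])
      fix j
      have "(\<Sum>i\<in>UNIV. adj (A x) $ i $ j * ((\<Sum>k\<in>UNIV. DV (W x) $ j $ k * A x $ k $ i) * \<phi> x))
        = (\<Sum>i\<in>UNIV. \<Sum>k\<in>UNIV. DV (W x) $ j $ k * (A x $ k $ i * adj (A x) $ i $ j) * \<phi> x)"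
        by (simp add: sum_distrib_left sum_distrib_right algebra_simps)
      also have "\<dots> = (\<Sum>k\<in>UNIV. DV (W x) $ j $ k * (\<Sum>i\<in>UNIV. A x $ k $ i * adj (A x) $ i $ j) * \<phi> x)"
        by (subst sum.swap) (simp add: sum_distrib_left sum_distrib_right)
      also have "\<dots> = DV (W x) $ j $ j * det (A x) * \<phi> x"
        by (simp add: mult_adj if_distrib if_distribR cong: if_cong)
      finally show "(\<Sum>i\<in>UNIV. adj (A x) $ i $ j * ((\<Sum>k\<in>UNIV. DV (W x) $ j $ k * A x $ k $ i) * \<phi> x))
        = DV (W x) $ j $ j * det (A x) * \<phi> x" .
    qed
    also have "(\<Sum>j\<in>UNIV. \<Sum>i\<in>UNIV. adj (A x) $ i $ j * (V (W x) $ j * g x $ i)) = (adj (A x) *v V (W x)) \<bullet> g x"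
      unfolding inner_vec_def matrix_vector_mult_def
      by (subst sum.swap) (simp add: sum_distrib_right mult.assoc)
    finally show ?thesis by (simp add: mtrace_def sum_distrib_right)
  qed
  moreover have "integrable lborel (\<lambda>x. (adj (A x) *v V (W x)) \<bullet> g x)"
  proof (rule integrable_compact_support[OF _ K(1)])
    show "continuous_on UNIV (\<lambda>x. (adj (A x) *v V (W x)) \<bullet> g x)"
      unfolding inner_vec_def matrix_vector_mult_def
      by simp (intro continuous_intros contadj contVW contg)
    show "(adj (A x) *v V (W x)) \<bullet> g x = 0" if "x \<notin> K" for x
      using has_derivative_zero_outside[OF \<phi> compact_imp_closed[OF K(1)] K(2) that] by (simp add: fun_eq_iff)
  qed
  moreover have "integrable lborel (\<lambda>x. mtrace (DV (W x)) * det (A x) * \<phi> x)"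
    unfolding mtrace_def
    by (rule integrable_compact_support[OF _ K(1)])
      (auto intro!: continuous_intros continuous_on_det contA contDVW cont\<phi> simp: K(2))
  ultimately show ?thesis by (simp add: Bochner_Integration.integral_add)
qed

section \<open>Continuity of translation in $L^p$\<close>

lemma integrable_translation_difference:
  fixes f :: "'a::euclidean_space \<Rightarrow> real"
  assumes "integrable lborel f"
  shows "integrable lborel (\<lambda>x. \<bar>f (h + x) - f x\<bar>)"
  using integrable_lborel_translate[OF assms] assms by auto

text \<open>Openness gives pointwise convergence at points of U, but a boundary point may be shifted
  into U by every s n. So dominated convergence is applied only to the mass lost from U; the mass
  gained has the same integral by translation invariance.\<close>

lemma L1_translation_continuous_open:
  fixes U :: "'a::euclidean_space set"
  assumes "open U" "emeasure lborel U < \<infinity>"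
  shows "((\<lambda>h. \<integral>x. \<bar>indicator U (h + x) - indicator U x :: real\<bar> \<partial>lborel) \<longlongrightarrow> 0) (at 0)"
  unfolding tendsto_at_iff_sequentially
proof safe
  fix s :: "nat \<Rightarrow> 'a" assume s: "s \<longlonglongrightarrow> 0"
  let ?I = "indicator U :: 'a \<Rightarrow> real"
  have [measurable]: "U \<in> sets borel" using assms by simp
  have int: "integrable lborel ?I"
    using assms by (simp add: integrable_indicator_iff)
  define q where "q n x = max 0 (?I x - ?I (s n + x))" for n x
  have [measurable]: "q n \<in> borel_measurable borel" for n
    unfolding q_def[abs_def] by measurable
  have intq: "integrable lborel (q n)" for n
    by (rule Bochner_Integration.integrable_bound[OF int]) (auto simp: q_def indicator_def)
  have "(\<lambda>n. \<integral>x. q n x \<partial>lborel) \<longlonglongrightarrow> (\<integral>x. 0 \<partial>(lborel :: 'a measure))"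
  proof (rule integral_dominated_convergence[where w="?I"])
    show "AE x in lborel. (\<lambda>n. q n x) \<longlonglongrightarrow> 0"
    proof (rule AE_I2)
      fix x
      show "(\<lambda>n. q n x) \<longlonglongrightarrow> 0"
      proof (cases "x \<in> U")
        case True
        have "(\<lambda>n. s n + x) \<longlonglongrightarrow> 0 + x"
          by (intro tendsto_intros s)
        then have "eventually (\<lambda>n. s n + x \<in> U) sequentially"
          using assms(1) True by (auto dest: topological_tendstoD)
        then have "eventually (\<lambda>n. q n x = 0) sequentially"
          by eventually_elim (simp add: q_def)
        then show ?thesis by (rule tendsto_eventually)
      qed (simp add: q_def)
    qed
    show "AE x in lborel. norm (q n x) \<le> ?I x" for n
      by (auto simp: q_def indicator_def)
  qed (auto simp: int)
  moreover have "(\<integral>x. \<bar>?I (s n + x) - ?I x\<bar> \<partial>lborel) = 2 * (\<integral>x. q n x \<partial>lborel)" for n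
  proof -
    \<comment> \<open>With a the difference, |a| = 2 max(0, -a) + a, and a has integral
      zero.\<close>
    have "(\<integral>x. \<bar>?I (s n + x) - ?I x\<bar> \<partial>lborel) = (\<integral>x. 2 * q n x + (?I (s n + x) - ?I x) \<partial>lborel)"
      by (rule Bochner_Integration.integral_cong) (auto simp: q_def max_def)
    also have "\<dots> = 2 * (\<integral>x. q n x \<partial>lborel) + ((\<integral>x. ?I (s n + x) \<partial>lborel) - (\<integral>x. ?I x \<partial>lborel))"
      using intq int integrable_lborel_translate[OF int, of "s n"]
      by (subst Bochner_Integration.integral_add) (auto simp: Bochner_Integration.integral_diff)
    also have "\<dots> = 2 * (\<integral>x. q n x \<partial>lborel)"
      by (subst integral_lborel_translate) auto
    finally show ?thesis .
  qed
  ultimately show "((\<lambda>h. \<integral>x. \<bar>?I (h + x) - ?I x\<bar> \<partial>lborel) \<circ> s) \<longlonglongrightarrow> 0"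
    by (auto simp: o_def intro!: tendsto_mult_right_zero)
qed

text \<open>Induction over integrable functions: outer regularity reduces a measurable set to an
  open superset, and the limit case is an approximation in L^1 whose error is invariant under
  translation.\<close>

lemma L1_translation_continuous:
  fixes f :: "'a::euclidean_space \<Rightarrow> real"
  assumes "integrable lborel f"
  shows "((\<lambda>h. \<integral>x. \<bar>f (h + x) - f x\<bar> \<partial>lborel) \<longlongrightarrow> 0) (at 0)"
  using assms
proof induction
  case (base A c)
  have [measurable]: "A \<in> sets borel" using base by simp
  let ?D = "\<lambda>(A::'a set) h. \<integral>x. \<bar>indicator A (h + x) - indicator A x :: real\<bar> \<partial>lborel"
  have "(?D A \<longlongrightarrow> 0) (at 0)"
  proof (rule tendstoI)
    fix e :: real assume "e > 0"
    \<comment> \<open>The indicator of U - A enters the estimate twice, translated and untranslated;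
      a quarter each leaves e / 2 for the open set.\<close>
    then have "e / 4 > 0" by simp
    with outer_regular_lborel[of A "e / 4"]
    obtain U where U: "open U" "A \<subseteq> U" "emeasure lborel (U - A) < ennreal (e / 4)"
      by auto
    have [measurable]: "U \<in> sets borel" using U by simp
    have "emeasure lborel U = emeasure lborel A + emeasure lborel (U - A)"
      using U by (subst plus_emeasure) (auto simp: Un_absorb1)
    also have "\<dots> < \<infinity>"
      using base order.strict_trans[OF U(3) ennreal_less_top] by (simp add: ennreal_add_less_top)
    finally have Ufin: "emeasure lborel U < \<infinity>" .
    let ?J = "indicator (U - A) :: 'a \<Rightarrow> real"
    have J: "integrable lborel ?J"
      using U(3) by (auto simp: integrable_indicator_iff intro: order.strict_trans)
    have mJ: "(\<integral>x. ?J x \<partial>lborel) < e / 4"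
      using U(3) \<open>e > 0\<close> order.strict_trans[OF U(3) ennreal_less_top]
      by (simp add: emeasure_eq_ennreal_measure ennreal_less_iff)
    have intU: "integrable lborel (indicator U :: 'a \<Rightarrow> real)" and intA: "integrable lborel (indicator A :: 'a \<Rightarrow> real)"
      using Ufin base by (simp_all add: integrable_indicator_iff)
    have "eventually (\<lambda>h. dist (?D U h) 0 < e / 2) (at 0)"
      using \<open>e > 0\<close> by (intro tendstoD[OF L1_translation_continuous_open[OF U(1) Ufin]]) simp
    then show "eventually (\<lambda>h. dist (?D A h) 0 < e) (at 0)"
    proof eventually_elim
      case (elim h)
      have "?D A h \<le> (\<integral>x. (?J (h + x) + ?J x) + \<bar>indicator U (h + x) - indicator U x\<bar> \<partial>lborel)"
        using U(2)
        by (intro integral_mono integrable_translation_difference intU intA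
            Bochner_Integration.integrable_add J integrable_lborel_translate) (auto simp: indicator_def)
      also have "\<dots> = (\<integral>x. ?J (h + x) \<partial>lborel) + (\<integral>x. ?J x \<partial>lborel) + ?D U h"
        using integrable_translation_difference[OF intU, of h] J integrable_lborel_translate[OF J, of h]
        by (simp add: Bochner_Integration.integral_add)
      also have "\<dots> < e"
        using mJ elim integral_lborel_translate[of ?J h] by simp
      finally show ?case by simp
    qed
  qed
  then have "((\<lambda>h. \<bar>c\<bar> * ?D A h) \<longlongrightarrow> 0) (at 0)"
    by (rule tendsto_mult_right_zero)
  moreover have "\<bar>indicator A (h + x) *\<^sub>R c - indicator A x *\<^sub>R c\<bar> = \<bar>c\<bar> * \<bar>indicator A (h + x) - indicator A x\<bar>" for h x
    by (simp add: abs_mult[symmetric] algebra_simps)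
  ultimately show ?case by simp
next
  case (add f g)
  show ?case
  proof (rule tendsto_sandwich[OF _ _ tendsto_const tendsto_add_zero[OF add.IH]])
    show "eventually (\<lambda>h. (\<integral>x. \<bar>f (h + x) + g (h + x) - (f x + g x)\<bar> \<partial>lborel)
        \<le> (\<integral>x. \<bar>f (h + x) - f x\<bar> \<partial>lborel) + (\<integral>x. \<bar>g (h + x) - g x\<bar> \<partial>lborel)) (at 0)"
    proof (rule always_eventually, rule allI)
      fix h
      note i = integrable_translation_difference[OF add.hyps(1), of h] integrable_translation_difference[OF add.hyps(2), of h]
      have "(\<integral>x. \<bar>f (h + x) + g (h + x) - (f x + g x)\<bar> \<partial>lborel)
        \<le> (\<integral>x. \<bar>f (h + x) - f x\<bar> + \<bar>g (h + x) - g x\<bar> \<partial>lborel)"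
        using integrable_translation_difference[OF Bochner_Integration.integrable_add[OF add.hyps], of h] i
        by (intro integral_mono) auto
      then show "(\<integral>x. \<bar>f (h + x) + g (h + x) - (f x + g x)\<bar> \<partial>lborel)
        \<le> (\<integral>x. \<bar>f (h + x) - f x\<bar> \<partial>lborel) + (\<integral>x. \<bar>g (h + x) - g x\<bar> \<partial>lborel)"
        using i by simp
    qed
  qed simp
next
  case (lim f s)
  have [measurable]: "f \<in> borel_measurable borel" "\<And>i. s i \<in> borel_measurable borel"
    using lim.hyps(1)[THEN borel_measurable_integrable] lim.hyps(4)[THEN borel_measurable_integrable] by simp_all
  have "(\<lambda>i. \<integral>x. \<bar>s i x - f x\<bar> \<partial>lborel) \<longlonglongrightarrow> (\<integral>x. 0 \<partial>(lborel :: 'a measure))"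
  \<comment> \<open>The approximants supplied by the induction satisfy |s i| \<le> 2 |f|, whence the
    factor 3.\<close>
  proof (rule integral_dominated_convergence[where w="\<lambda>x. 3 * \<bar>f x\<bar>"])
    show "AE x in lborel. (\<lambda>i. \<bar>s i x - f x\<bar>) \<longlonglongrightarrow> 0"
      using lim.hyps(2) by (auto intro!: AE_I2 tendsto_rabs_zero simp: LIM_zero_iff)
    show "AE x in lborel. norm \<bar>s i x - f x\<bar> \<le> 3 * \<bar>f x\<bar>" for i
    proof (rule AE_I2)
      fix x show "norm \<bar>s i x - f x\<bar> \<le> 3 * \<bar>f x\<bar>" using lim.hyps(3)[of x i] by auto
    qed
  qed (use lim.hyps(4) in auto)
  then have L: "(\<lambda>i. \<integral>x. \<bar>s i x - f x\<bar> \<partial>lborel) \<longlonglongrightarrow> 0" by simp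
  show ?case
  proof (rule tendstoI)
    fix e :: real assume "e > 0"
    then have "eventually (\<lambda>i. dist (\<integral>x. \<bar>s i x - f x\<bar> \<partial>lborel) 0 < e / 4) sequentially"
      by (intro tendstoD[OF L]) simp
    then obtain i where i: "(\<integral>x. \<bar>s i x - f x\<bar> \<partial>lborel) < e / 4"
      by (auto simp: eventually_sequentially)
    have "eventually (\<lambda>h. dist (\<integral>x. \<bar>s i (h + x) - s i x\<bar> \<partial>lborel) 0 < e / 2) (at 0)"
      using \<open>e > 0\<close> by (intro tendstoD[OF lim.IH]) simp
    then show "eventually (\<lambda>h. dist (\<integral>x. \<bar>f (h + x) - f x\<bar> \<partial>lborel) 0 < e) (at 0)"
    proof eventually_elim
      case (elim h)
      have J: "integrable lborel (\<lambda>x. \<bar>s i x - f x\<bar>)"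
        using lim.hyps(1)[of i] lim.hyps(4) by auto
      note J' = integrable_lborel_translate[OF J, of h]
      note I = integrable_translation_difference[OF lim.hyps(1)[of i], of h]
      have "(\<integral>x. \<bar>f (h + x) - f x\<bar> \<partial>lborel)
        \<le> (\<integral>x. (\<bar>s i (h + x) - f (h + x)\<bar> + \<bar>s i x - f x\<bar>) + \<bar>s i (h + x) - s i x\<bar> \<partial>lborel)"
        by (intro integral_mono integrable_translation_difference lim.hyps(4)
            Bochner_Integration.integrable_add I J J') auto
      also have "\<dots> = (\<integral>x. \<bar>s i (h + x) - f (h + x)\<bar> \<partial>lborel) + (\<integral>x. \<bar>s i x - f x\<bar> \<partial>lborel)
          + (\<integral>x. \<bar>s i (h + x) - s i x\<bar> \<partial>lborel)"
        using I J J' by (simp add: Bochner_Integration.integral_add)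
      also have "\<dots> < e"
        using i elim integral_lborel_translate[of "\<lambda>x. \<bar>s i x - f x\<bar>" h] by simp
      finally show ?case by simp
    qed
  qed
qed

section \<open>Power inequalities and the passage from L^1 to L^p\<close>

lemma power_diff_superadditive:
  fixes a b :: real
  assumes "0 \<le> b" "b \<le> a" "1 \<le> p"
  shows "(a - b) ^ p \<le> a ^ p - b ^ p"
  using assms(3)
proof (induction p rule: dec_induct)
  case (step p)
  have "(a - b) ^ Suc p \<le> (a - b) * (a ^ p - b ^ p)"
    using step assms by (simp add: mult_left_mono)
  also have "\<dots> = a ^ Suc p - b ^ Suc p - (b * (a ^ p - b ^ p) + (a - b) * b ^ p)"
    by (simp add: algebra_simps)
  also have "\<dots> \<le> a ^ Suc p - b ^ Suc p"
  proof -
    have "0 \<le> b * (a ^ p - b ^ p)" "0 \<le> (a - b) * b ^ p"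
      using assms power_mono[of b a p] by simp_all
    then show ?thesis by linarith
  qed
  finally show ?case .
qed simp

lemma power_add_le:
  fixes a b :: real
  assumes "0 \<le> a" "0 \<le> b"
  shows "(a + b) ^ p \<le> 2 ^ p * (a ^ p + b ^ p)"
proof -
  have "(a + b) ^ p \<le> (2 * max a b) ^ p"
    using assms by (intro power_mono) auto
  also have "\<dots> = 2 ^ p * max a b ^ p" by (simp add: power_mult_distrib)
  also have "\<dots> \<le> 2 ^ p * (a ^ p + b ^ p)"
    using assms by (auto simp: max_def)
  finally show ?thesis .
qed

text \<open>Reduces translation continuity in $L^p$ to the case $p = 1$, applied to $g |g|^{p-1}$.\<close>

lemma abs_diff_power_le:
  fixes a b :: real
  assumes "1 \<le> p"
  shows "\<bar>a - b\<bar> ^ p \<le> 2 ^ p * \<bar>a * \<bar>a\<bar> ^ (p - 1) - b * \<bar>b\<bar> ^ (p - 1)\<bar>"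
proof -
  obtain q where p: "p = Suc q" using assms by (cases p) auto
  have two: "x \<le> 2 ^ p * x" if "0 \<le> x" for x :: real
    using mult_right_mono[of 1 "2 ^ p :: real" x] that by simp
  have *: "\<bar>a - b\<bar> ^ p \<le> 2 ^ p * \<bar>a * \<bar>a\<bar> ^ q - b * \<bar>b\<bar> ^ q\<bar>" if "b \<le> a" for a b :: real
  proof -
    \<comment> \<open>For equal signs superadditivity of the power suffices. For opposite signs |a -
      b| = |a| + |b|, where \<open>power_add_le\<close> costs the factor 2^p, which the other cases
      then concede as well.\<close>
    consider "0 \<le> b" | "b < 0" "0 \<le> a" | "a < 0" using that by linarith
    then show ?thesis
    proof cases
      case 1
      have "(a - b) ^ p \<le> a ^ p - b ^ p"
        by (rule power_diff_superadditive[OF 1 that assms])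
      also have "\<dots> \<le> 2 ^ p * (a ^ p - b ^ p)"
        using 1 that by (intro two) (simp add: power_mono)
      finally show ?thesis using 1 that power_mono[OF that 1, of p] by (simp add: p)
    next
      case 2
      have "(a + (- b)) ^ p \<le> 2 ^ p * (a ^ p + (- b) ^ p)"
        using 2 by (intro power_add_le) auto
      moreover have "a * \<bar>a\<bar> ^ q - b * \<bar>b\<bar> ^ q = a ^ p + (- b) ^ p"
        using 2 by (simp add: p)
      moreover have "0 \<le> a ^ p + (- b) ^ p" using 2 by simp
      ultimately show ?thesis using 2 by simp
    next
      case 3
      have "((- b) - (- a)) ^ p \<le> (- b) ^ p - (- a) ^ p"
        using 3 that by (intro power_diff_superadditive assms) auto
      also have "\<dots> \<le> 2 ^ p * ((- b) ^ p - (- a) ^ p)"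
        using 3 that by (intro two) (simp add: power_mono)
      finally have "(a - b) ^ p \<le> 2 ^ p * ((- b) ^ p - (- a) ^ p)" by (simp add: algebra_simps)
      moreover have "a * \<bar>a\<bar> ^ q - b * \<bar>b\<bar> ^ q = (- b) ^ p - (- a) ^ p"
        using 3 that by (simp add: p)
      moreover have "0 \<le> (- b) ^ p - (- a) ^ p" using 3 that by (simp add: power_mono)
      ultimately show ?thesis using 3 that by simp
    qed
  qed
  show ?thesis
    using *[of b a] *[of a b] by (cases "b \<le> a") (auto simp: p abs_minus_commute)
qed

lemma Lp_translation_continuous:
  fixes g :: "'a::euclidean_space \<Rightarrow> real"
  assumes [measurable]: "g \<in> borel_measurable borel" and p: "1 \<le> p"
    and int: "integrable lborel (\<lambda>x. \<bar>g x\<bar> ^ p)"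
  shows "((\<lambda>h. \<integral>x. \<bar>g (h + x) - g x\<bar> ^ p \<partial>lborel) \<longlongrightarrow> 0) (at 0)"
proof -
  define G where "G x = g x * \<bar>g x\<bar> ^ (p - 1)" for x
  have [measurable]: "G \<in> borel_measurable borel" unfolding G_def[abs_def] by measurable
  have "\<bar>G x\<bar> = \<bar>g x\<bar> ^ p" for x
    using p by (cases p) (simp_all add: G_def abs_mult)
  then have G: "integrable lborel G"
    by (intro Bochner_Integration.integrable_bound[OF int]) auto
  have le: "\<bar>g (h + x) - g x\<bar> ^ p \<le> 2 ^ p * \<bar>G (h + x) - G x\<bar>" for h x
    unfolding G_def by (rule abs_diff_power_le[OF p])
  have I: "integrable lborel (\<lambda>x. 2 ^ p * \<bar>G (h + x) - G x\<bar>)" for h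
    using integrable_translation_difference[OF G, of h] by simp
  show ?thesis
  proof (rule tendsto_sandwich[OF _ _ tendsto_const tendsto_mult_right_zero[OF L1_translation_continuous[OF G], of "2 ^ p"]])
    show "eventually (\<lambda>h. (\<integral>x. \<bar>g (h + x) - g x\<bar> ^ p \<partial>lborel) \<le> 2 ^ p * (\<integral>x. \<bar>G (h + x) - G x\<bar> \<partial>lborel)) (at 0)"
    proof (rule always_eventually, rule allI)
      fix h
      have "integrable lborel (\<lambda>x. \<bar>g (h + x) - g x\<bar> ^ p)"
        using le by (intro Bochner_Integration.integrable_bound[OF I[of h]]) (auto intro: order.trans)
      then have "(\<integral>x. \<bar>g (h + x) - g x\<bar> ^ p \<partial>lborel) \<le> (\<integral>x. 2 ^ p * \<bar>G (h + x) - G x\<bar> \<partial>lborel)"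
        by (intro integral_mono I le)
      then show "(\<integral>x. \<bar>g (h + x) - g x\<bar> ^ p \<partial>lborel) \<le> 2 ^ p * (\<integral>x. \<bar>G (h + x) - G x\<bar> \<partial>lborel)"
        by simp
    qed
  qed simp
qed

section \<open>Mollification\<close>

lemma convex_on_abs_power:
  assumes "1 \<le> p"
  shows "convex_on UNIV (\<lambda>t::real. \<bar>t\<bar> ^ p)"
proof (cases "even p")
  case True
  then show ?thesis using convex_power_even[OF True] by (simp add: power_even_abs)
next
  case False
  have c: "convex_on {0..} (\<lambda>t::real. t ^ p)"
    using convex_power_odd[OF False] .
  show ?thesis
  proof (rule convex_onI)
    fix t x y :: real assume t: "0 < t" "t < 1"
    have "\<bar>(1 - t) *\<^sub>R x + t *\<^sub>R y\<bar> ^ p \<le> ((1 - t) * \<bar>x\<bar> + t * \<bar>y\<bar>) ^ p"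
      using t abs_triangle_ineq[of "(1 - t) * x" "t * y"] by (intro power_mono) (auto simp: abs_mult)
    also have "\<dots> \<le> (1 - t) * \<bar>x\<bar> ^ p + t * \<bar>y\<bar> ^ p"
      using convex_onD[OF c, of t "\<bar>x\<bar>" "\<bar>y\<bar>"] t by simp
    finally show "\<bar>(1 - t) *\<^sub>R x + t *\<^sub>R y\<bar> ^ p \<le> (1 - t) * \<bar>x\<bar> ^ p + t * \<bar>y\<bar> ^ p" .
  qed simp
qed

lemma le_one_plus_power:
  fixes t :: real
  assumes "1 \<le> p" "0 \<le> t"
  shows "t \<le> 1 + t ^ p"
proof (cases "t \<le> 1")
  case True
  then show ?thesis using assms zero_le_power[of t p] by linarith
next
  case False
  then have "t ^ 1 \<le> t ^ p" using assms by (intro power_increasing) auto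
  then show ?thesis by simp
qed

text \<open>The mollification is an average of translates for the probability measure with density
  \<rho>. Jensen bounds |m - g|^p by the average of |g(z + x) - g x|^p over z, Tonelli exchanges the
  integrals, and each shift z charged by \<rho> costs at most e.\<close>

lemma mollification_Lp_error:
  fixes g \<rho> :: "'a::euclidean_space \<Rightarrow> real"
  assumes [measurable]: "g \<in> borel_measurable borel" "\<rho> \<in> borel_measurable borel" and p: "1 \<le> p"
    and int: "integrable lborel (\<lambda>x. \<bar>g x\<bar> ^ p)"
    and \<rho>: "integrable lborel \<rho>" "(\<integral>z. \<rho> z \<partial>lborel) = 1" "\<And>z. 0 \<le> \<rho> z" "\<And>z. \<rho> z \<le> M"
    and err: "\<And>z. \<rho> z \<noteq> 0 \<Longrightarrow> (\<integral>x. \<bar>g (z + x) - g x\<bar> ^ p \<partial>lborel) \<le> e"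
    and e: "0 \<le> e"
  defines "m \<equiv> \<lambda>x. \<integral>y. g y * \<rho> (y - x) \<partial>lborel"
  shows "integrable lborel (\<lambda>x. \<bar>m x - g x\<bar> ^ p)" "(\<integral>x. \<bar>m x - g x\<bar> ^ p \<partial>lborel) \<le> e"
proof -
  have [measurable]: "m \<in> borel_measurable borel"
    unfolding m_def by measurable
  have M: "0 \<le> M" using \<rho>(3,4)[of undefined] by linarith
  define P where "P = density lborel (\<lambda>z. ennreal (\<rho> z))"
  have "emeasure P (space P) = 1"
    unfolding P_def using nn_integral_eq_integral[OF \<rho>(1)] \<rho>(2,3) by (simp add: emeasure_density)
  then interpret P: prob_space P by (rule prob_spaceI)
  have intd: "integrable lborel (\<lambda>x. \<bar>g (z + x) - g x\<bar> ^ p)" for z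
  proof (rule Bochner_Integration.integrable_bound)
    show "integrable lborel (\<lambda>x. 2 ^ p * (\<bar>g (z + x)\<bar> ^ p + \<bar>g x\<bar> ^ p))"
      using integrable_lborel_translate[OF int, of z] int by auto
    show "AE x in lborel. norm (\<bar>g (z + x) - g x\<bar> ^ p) \<le> norm (2 ^ p * (\<bar>g (z + x)\<bar> ^ p + \<bar>g x\<bar> ^ p))"
    proof (rule AE_I2)
      fix x
      have "\<bar>g (z + x) - g x\<bar> ^ p \<le> (\<bar>g (z + x)\<bar> + \<bar>g x\<bar>) ^ p" by (intro power_mono) auto
      also have "\<dots> \<le> 2 ^ p * (\<bar>g (z + x)\<bar> ^ p + \<bar>g x\<bar> ^ p)" by (intro power_add_le) auto
      finally show "norm (\<bar>g (z + x) - g x\<bar> ^ p) \<le> norm (2 ^ p * (\<bar>g (z + x)\<bar> ^ p + \<bar>g x\<bar> ^ p))" by simp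
    qed
  qed measurable
  \<comment> \<open>Formulated in \<open>ennreal\<close> so that Tonelli applies before the
    left-hand side is known to be integrable; its integrability is read off at the end.\<close>
  have pointwise: "ennreal (\<bar>m x - g x\<bar> ^ p) \<le> (\<integral>\<^sup>+z. ennreal (\<rho> z * \<bar>g (z + x) - g x\<bar> ^ p) \<partial>lborel)" for x
  proof -
    \<comment> \<open>The bound M on \<rho> gives integrability for every x, not just for almost
      every x.\<close>
    have i1: "integrable lborel (\<lambda>z. \<rho> z * \<bar>g (x + z)\<bar> ^ p)"
    proof (rule Bochner_Integration.integrable_bound)
      show "integrable lborel (\<lambda>z. M * \<bar>g (x + z)\<bar> ^ p)"
        using integrable_lborel_translate[OF int, of x] by simp
      show "AE z in lborel. norm (\<rho> z * \<bar>g (x + z)\<bar> ^ p) \<le> norm (M * \<bar>g (x + z)\<bar> ^ p)"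
        using \<rho>(3,4) M by (auto simp: abs_mult intro!: mult_right_mono)
    qed measurable
    have i2: "integrable lborel (\<lambda>z. \<rho> z * g (x + z))"
    proof (rule Bochner_Integration.integrable_bound)
      show "integrable lborel (\<lambda>z. \<rho> z + \<rho> z * \<bar>g (x + z)\<bar> ^ p)"
        using \<rho>(1) i1 by simp
      show "AE z in lborel. norm (\<rho> z * g (x + z)) \<le> norm (\<rho> z + \<rho> z * \<bar>g (x + z)\<bar> ^ p)"
      proof (rule AE_I2)
        fix z
        have "\<rho> z * \<bar>g (x + z)\<bar> \<le> \<rho> z * (1 + \<bar>g (x + z)\<bar> ^ p)"
          using \<rho>(3) by (intro mult_left_mono le_one_plus_power p) auto
        then show "norm (\<rho> z * g (x + z)) \<le> norm (\<rho> z + \<rho> z * \<bar>g (x + z)\<bar> ^ p)"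
          using \<rho>(3)[of z] by (simp add: abs_mult algebra_simps)
      qed
    qed measurable
    have i3: "integrable lborel (\<lambda>z. \<rho> z * \<bar>g (x + z) - g x\<bar> ^ p)"
    proof (rule Bochner_Integration.integrable_bound)
      show "integrable lborel (\<lambda>z. 2 ^ p * (\<rho> z * \<bar>g (x + z)\<bar> ^ p + \<rho> z * \<bar>g x\<bar> ^ p))"
        using \<rho>(1) i1 by simp
      show "AE z in lborel. norm (\<rho> z * \<bar>g (x + z) - g x\<bar> ^ p) \<le> norm (2 ^ p * (\<rho> z * \<bar>g (x + z)\<bar> ^ p + \<rho> z * \<bar>g x\<bar> ^ p))"
      proof (rule AE_I2)
        fix z
        have "\<bar>g (x + z) - g x\<bar> ^ p \<le> (\<bar>g (x + z)\<bar> + \<bar>g x\<bar>) ^ p" by (intro power_mono) auto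
        also have "\<dots> \<le> 2 ^ p * (\<bar>g (x + z)\<bar> ^ p + \<bar>g x\<bar> ^ p)" by (intro power_add_le) auto
        finally have "\<rho> z * \<bar>g (x + z) - g x\<bar> ^ p \<le> \<rho> z * (2 ^ p * (\<bar>g (x + z)\<bar> ^ p + \<bar>g x\<bar> ^ p))"
          by (rule mult_left_mono) (rule \<rho>)
        then show "norm (\<rho> z * \<bar>g (x + z) - g x\<bar> ^ p) \<le> norm (2 ^ p * (\<rho> z * \<bar>g (x + z)\<bar> ^ p + \<rho> z * \<bar>g x\<bar> ^ p))"
          using \<rho>(3)[of z] by (simp add: abs_mult algebra_simps)
      qed
    qed measurable
    have "m x = (\<integral>z. \<rho> z * g (x + z) \<partial>lborel)"
      unfolding m_def using integral_lborel_translate[of "\<lambda>y. g y * \<rho> (y - x)" x] by (simp add: mult.commute)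
    then have "m x - g x = (\<integral>z. \<rho> z * (g (x + z) - g x) \<partial>lborel)"
      using i2 \<rho>(1,2) by (simp add: right_diff_distrib Bochner_Integration.integral_diff)
    also have "\<dots> = P.expectation (\<lambda>z. g (x + z) - g x)"
      unfolding P_def using \<rho>(3) by (subst integral_density) auto
    finally have "\<bar>m x - g x\<bar> ^ p = \<bar>P.expectation (\<lambda>z. g (x + z) - g x)\<bar> ^ p" by simp
    also have "\<dots> \<le> P.expectation (\<lambda>z. \<bar>g (x + z) - g x\<bar> ^ p)"
    proof (rule P.jensens_inequality[where I=UNIV and q="\<lambda>t. \<bar>t\<bar> ^ p"])
      show "integrable P (\<lambda>z. g (x + z) - g x)"
        unfolding P_def using \<rho>(1,3) i2 by (subst integrable_density) (auto simp: right_diff_distrib)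
      show "integrable P (\<lambda>z. \<bar>g (x + z) - g x\<bar> ^ p)"
        unfolding P_def using \<rho>(3) i3 by (subst integrable_density) auto
    qed (auto intro: convex_on_abs_power p)
    also have "\<dots> = (\<integral>z. \<rho> z * \<bar>g (x + z) - g x\<bar> ^ p \<partial>lborel)"
      unfolding P_def using \<rho>(3) by (subst integral_density) auto
    finally have "ennreal (\<bar>m x - g x\<bar> ^ p) \<le> ennreal (\<integral>z. \<rho> z * \<bar>g (x + z) - g x\<bar> ^ p \<partial>lborel)"
      by (rule ennreal_leI)
    also have "\<dots> = (\<integral>\<^sup>+z. ennreal (\<rho> z * \<bar>g (x + z) - g x\<bar> ^ p) \<partial>lborel)"
      using \<rho>(3) by (intro nn_integral_eq_integral[symmetric] i3) auto
    finally show ?thesis by (simp add: add.commute)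
  qed
  have "(\<integral>\<^sup>+x. ennreal (\<bar>m x - g x\<bar> ^ p) \<partial>lborel)
      \<le> (\<integral>\<^sup>+x. (\<integral>\<^sup>+z. ennreal (\<rho> z * \<bar>g (z + x) - g x\<bar> ^ p) \<partial>lborel) \<partial>lborel)"
    by (intro nn_integral_mono pointwise)
  also have "\<dots> = (\<integral>\<^sup>+z. (\<integral>\<^sup>+x. ennreal (\<rho> z * \<bar>g (z + x) - g x\<bar> ^ p) \<partial>lborel) \<partial>lborel)"
    by (rule lborel_pair.Fubini'[symmetric]) measurable
  also have "\<dots> \<le> (\<integral>\<^sup>+z. ennreal (\<rho> z * e) \<partial>lborel)"
  proof (rule nn_integral_mono)
    fix z
    have "(\<integral>\<^sup>+x. ennreal (\<rho> z * \<bar>g (z + x) - g x\<bar> ^ p) \<partial>lborel) = ennreal (\<integral>x. \<rho> z * \<bar>g (z + x) - g x\<bar> ^ p \<partial>lborel)"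
      using \<rho>(3) intd[of z] by (intro nn_integral_eq_integral) auto
    also have "\<dots> \<le> ennreal (\<rho> z * e)"
      using err[of z] \<rho>(3)[of z] by (cases "\<rho> z = 0") (auto intro!: ennreal_leI mult_left_mono)
    finally show "(\<integral>\<^sup>+x. ennreal (\<rho> z * \<bar>g (z + x) - g x\<bar> ^ p) \<partial>lborel) \<le> ennreal (\<rho> z * e)" .
  qed
  also have "\<dots> = ennreal (\<integral>z. \<rho> z * e \<partial>lborel)"
    using \<rho>(1,3) e by (intro nn_integral_eq_integral) auto
  also have "\<dots> = ennreal e" using \<rho>(2) by simp
  finally have le: "(\<integral>\<^sup>+x. ennreal (\<bar>m x - g x\<bar> ^ p) \<partial>lborel) \<le> ennreal e" .
  then show int': "integrable lborel (\<lambda>x. \<bar>m x - g x\<bar> ^ p)"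
    by (intro integrableI_bounded) (auto intro: order.strict_trans1)
  show "(\<integral>x. \<bar>m x - g x\<bar> ^ p \<partial>lborel) \<le> e"
    using le nn_integral_eq_integral[OF int'] e by simp
qed

text \<open>Picking members with integral below 2^-k makes the series of integrals converge, so the
  pointwise series is integrable and almost everywhere finite. Its terms then tend to zero and its
  sum dominates each of them. Here r is merely a choice of indices; convergence comes from
  summability, not from monotonicity of r.\<close>

lemma summable_subsequence_dominated:
  fixes S :: "nat \<Rightarrow> 'a \<Rightarrow> real"
  assumes int: "\<And>k. integrable M (S k)" and nonneg: "\<And>k x. 0 \<le> S k x"
    and lim: "(\<lambda>k. \<integral>x. S k x \<partial>M) \<longlonglongrightarrow> 0"
  obtains r :: "nat \<Rightarrow> nat" and h where "integrable M h" "AE x in M. (\<lambda>k. S (r k) x) \<longlonglongrightarrow> 0"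
    "AE x in M. \<forall>k. S (r k) x \<le> h x"
proof -
  have "\<exists>n. (\<integral>x. S n x \<partial>M) < (1 / 2) ^ k" for k
  proof -
    have "eventually (\<lambda>n. (\<integral>x. S n x \<partial>M) < (1 / 2) ^ k) sequentially"
      using order_tendstoD(2)[OF lim, of "(1 / 2) ^ k"] by simp
    then show ?thesis by (auto simp: eventually_sequentially)
  qed
  then obtain r where r: "\<And>k. (\<integral>x. S (r k) x \<partial>M) < (1 / 2) ^ k" by metis
  have [measurable]: "S k \<in> borel_measurable M" for k using int by auto
  have sm: "summable (\<lambda>k. \<integral>x. S (r k) x \<partial>M)"
  proof (rule summable_comparison_test')
    show "summable (\<lambda>k. (1 / 2 :: real) ^ k)" by (simp add: summable_geometric)
    show "norm (\<integral>x. S (r k) x \<partial>M) \<le> (1 / 2) ^ k" if "0 \<le> k" for k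
      using r[of k] nonneg by (simp add: integral_nonneg)
  qed
  have "(\<integral>\<^sup>+x. (\<Sum>k. ennreal (S (r k) x)) \<partial>M) = (\<Sum>k. \<integral>\<^sup>+x. ennreal (S (r k) x) \<partial>M)"
    by (rule nn_integral_suminf) measurable
  also have "\<dots> = (\<Sum>k. ennreal (\<integral>x. S (r k) x \<partial>M))"
    using int nonneg by (simp add: nn_integral_eq_integral)
  also have "\<dots> \<noteq> \<infinity>"
    using sm nonneg by (simp add: ennreal_suminf_neq_top integral_nonneg)
  finally have "AE x in M. (\<Sum>k. ennreal (S (r k) x)) \<noteq> \<infinity>"
    by (intro nn_integral_PInf_AE) auto
  then have AE: "AE x in M. summable (\<lambda>k. S (r k) x)"
    by eventually_elim (auto intro: summable_suminf_not_top simp: nonneg)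
  show thesis
  proof
    show "integrable M (\<lambda>x. \<Sum>k. S (r k) x)"
      using AE sm nonneg by (intro integrable_suminf int) auto
    show "AE x in M. (\<lambda>k. S (r k) x) \<longlonglongrightarrow> 0"
      using AE by eventually_elim (rule summable_LIMSEQ_zero)
    show "AE x in M. \<forall>k. S (r k) x \<le> (\<Sum>k. S (r k) x)"
      using AE
    proof eventually_elim
      case (elim x)
      show ?case
        using sum_le_suminf[OF elim, of "{k}" for k] nonneg by auto
    qed
  qed
qed

section \<open>Convolution with a compactly supported kernel: continuity and differentiation\<close>

lemma integrable_convolution:
  fixes g \<eta> :: "'a::euclidean_space \<Rightarrow> real"
  assumes g: "integrable lborel g" and \<eta>: "continuous_on UNIV \<eta>" "\<And>z. z \<notin> cball 0 R \<Longrightarrow> \<eta> z = 0"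
  shows "integrable lborel (\<lambda>y. g y * \<eta> (y - x))"
proof -
  obtain M where M: "\<And>z. \<bar>\<eta> z\<bar> \<le> M"
    using bounded_compact_support[OF \<eta>(1) compact_cball \<eta>(2)] by blast
  have [measurable]: "\<eta> \<in> borel_measurable borel" "g \<in> borel_measurable borel"
    using \<eta>(1) g by (auto intro: borel_measurable_continuous_onI)
  show ?thesis
  proof (rule Bochner_Integration.integrable_bound)
    show "integrable lborel (\<lambda>y. M * g y)" using g by simp
    show "AE y in lborel. norm (g y * \<eta> (y - x)) \<le> norm (M * g y)"
    proof (rule AE_I2)
      fix y
      have "\<bar>g y\<bar> * \<bar>\<eta> (y - x)\<bar> \<le> \<bar>g y\<bar> * \<bar>M\<bar>"
        using M[of "y - x"] by (intro mult_left_mono) auto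
      then show "norm (g y * \<eta> (y - x)) \<le> norm (M * g y)" by (simp add: abs_mult mult.commute)
    qed
  qed measurable
qed

lemma uniformly_continuous_compact_support:
  fixes \<eta> :: "'a::euclidean_space \<Rightarrow> real"
  assumes \<eta>: "continuous_on UNIV \<eta>" "\<And>z. z \<notin> cball 0 R \<Longrightarrow> \<eta> z = 0"
  shows "uniformly_continuous_on UNIV \<eta>"
  unfolding uniformly_continuous_on_def
proof (intro allI impI)
  fix e :: real assume "e > 0"
  \<comment> \<open>The margin 1 handles pairs crossing the boundary: if points closer than 1 are
    not both in the larger ball, neither is in the ball of radius R, and both values are 0.\<close>
  have "uniformly_continuous_on (cball 0 (R + 1)) \<eta>"
    by (intro compact_uniformly_continuous continuous_on_subset[OF \<eta>(1)]) auto
  then obtain d where d: "d > 0" "\<And>x y. x \<in> cball 0 (R + 1) \<Longrightarrow> y \<in> cball 0 (R + 1) \<Longrightarrow> dist y x < d \<Longrightarrow> dist (\<eta> y) (\<eta> x) < e"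
    unfolding uniformly_continuous_on_def using \<open>e > 0\<close> by metis
  show "\<exists>d>0. \<forall>x\<in>UNIV. \<forall>y\<in>UNIV. dist y x < d \<longrightarrow> dist (\<eta> y) (\<eta> x) < e"
  proof (intro exI[of _ "min d 1"] conjI ballI impI)
    fix x y :: 'a assume xy: "dist y x < min d 1"
    show "dist (\<eta> y) (\<eta> x) < e"
    proof (cases "x \<in> cball 0 (R + 1) \<and> y \<in> cball 0 (R + 1)")
      case True
      then show ?thesis using d xy by auto
    next
      case False
      have "norm x \<le> norm y + dist y x" "norm y \<le> norm x + dist y x"
        by (metis dist_commute dist_norm norm_triangle_sub)+
      then have "x \<notin> cball 0 R" "y \<notin> cball 0 R" using False xy by auto
      then show ?thesis using \<eta>(2) \<open>e > 0\<close> by simp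
    qed
  qed (use d in auto)
qed

lemma continuous_on_convolution:
  fixes g \<eta> :: "'a::euclidean_space \<Rightarrow> real"
  assumes g: "integrable lborel g" and \<eta>: "continuous_on UNIV \<eta>" "\<And>z. z \<notin> cball 0 R \<Longrightarrow> \<eta> z = 0"
  shows "continuous_on UNIV (\<lambda>x. \<integral>y. g y * \<eta> (y - x) \<partial>lborel)"
proof -
  obtain M where M: "\<And>z. \<bar>\<eta> z\<bar> \<le> M"
    using bounded_compact_support[OF \<eta>(1) compact_cball \<eta>(2)] by blast
  have [measurable]: "\<eta> \<in> borel_measurable borel" "g \<in> borel_measurable borel"
    using \<eta>(1) g by (auto intro: borel_measurable_continuous_onI)
  show ?thesis
    unfolding continuous_on_sequentially
  proof (intro allI ballI impI, elim conjE)
    fix s and x :: 'a assume s: "s \<longlonglongrightarrow> x"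
    have "(\<lambda>n. \<integral>y. g y * \<eta> (y - s n) \<partial>lborel) \<longlonglongrightarrow> (\<integral>y. g y * \<eta> (y - x) \<partial>lborel)"
    proof (rule integral_dominated_convergence[where w="\<lambda>y. M * \<bar>g y\<bar>"])
      show "AE y in lborel. (\<lambda>n. g y * \<eta> (y - s n)) \<longlonglongrightarrow> g y * \<eta> (y - x)"
        by (intro AE_I2 tendsto_intros continuous_on_tendsto_compose[OF \<eta>(1)] s) auto
      show "AE y in lborel. norm (g y * \<eta> (y - s n)) \<le> M * \<bar>g y\<bar>" for n
        using M by (auto simp: abs_mult mult.commute[of M] intro!: mult_left_mono)
    qed (use g in auto)
    then show "((\<lambda>x. \<integral>y. g y * \<eta> (y - x) \<partial>lborel) \<circ> s) \<longlonglongrightarrow> (\<integral>y. g y * \<eta> (y - x) \<partial>lborel)"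
      by (simp add: o_def)
  qed
qed

text \<open>The point x enters as \<open>y - x\<close>, hence the minus sign. Uniform continuity of
  the partials d l makes the first-order remainder of \<eta> small uniformly in the base point, so
  integrating it against |g| costs only the L^1 norm of g.\<close>

lemma has_derivative_convolution:
  fixes g :: "real^'n \<Rightarrow> real" and \<eta> :: "real^'n \<Rightarrow> real"
  assumes g: "integrable lborel g"
    and der: "\<And>z. (\<eta> has_derivative (\<lambda>h. \<Sum>l\<in>UNIV. d l z * h $ l)) (at z)"
    and \<eta>: "\<And>z. z \<notin> cball 0 R \<Longrightarrow> \<eta> z = 0"
    and d: "\<And>l. continuous_on UNIV (d l)" "\<And>l z. z \<notin> cball 0 R \<Longrightarrow> d l z = 0"
  shows "((\<lambda>x. \<integral>y. g y * \<eta> (y - x) \<partial>lborel) has_derivative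
    (\<lambda>h. \<Sum>l\<in>UNIV. - (\<integral>y. g y * d l (y - x) \<partial>lborel) * h $ l)) (at x)"
  unfolding has_derivative_at_alt
proof (intro conjI allI impI)
  show "bounded_linear (\<lambda>h::real^'n. \<Sum>l\<in>UNIV. - (\<integral>y. g y * d l (y - x) \<partial>lborel) * h $ l)"
    by (intro bounded_linear_sum bounded_linear_const_mult bounded_linear_vec_nth)
  fix e :: real assume "e > 0"
  define G where "G = (\<integral>y. \<bar>g y\<bar> \<partial>lborel)"
  have "G \<ge> 0" unfolding G_def by (simp add: integral_nonneg)
  \<comment> \<open>CARD('n) pays for summing the errors of the partial derivatives, and G + 1 in
    place of G keeps the denominator positive when g vanishes almost everywhere.\<close>
  define e' where "e' = e / ((G + 1) * CARD('n))"
  have "e' > 0" using \<open>e > 0\<close> \<open>G \<ge> 0\<close> by (simp add: e'_def)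
  have "\<forall>l. \<exists>\<delta>>0. \<forall>x y. dist y x < \<delta> \<longrightarrow> dist (d l y) (d l x) < e'"
    using uniformly_continuous_compact_support[OF d] \<open>e' > 0\<close> unfolding uniformly_continuous_on_def by simp
  then obtain \<delta>' where \<delta>': "\<And>l. \<delta>' l > 0" "\<And>l x y. dist y x < \<delta>' l \<Longrightarrow> dist (d l y) (d l x) < e'"
    by metis
  define \<delta> where "\<delta> = Min (range \<delta>')"
  have "\<delta> > 0" using \<delta>'(1) by (simp add: \<delta>_def)
  have close: "\<bar>d l y - d l x\<bar> \<le> e'" if "dist y x < \<delta>" for l x y
  proof -
    have "\<delta> \<le> \<delta>' l" unfolding \<delta>_def by simp
    then show ?thesis using \<delta>'(2)[of y x l] that by (simp add: dist_real_def)
  qed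
  have contE: "continuous_on UNIV \<eta>"
    using der[THEN has_derivative_continuous] by (auto intro!: continuous_at_imp_continuous_on)
  have rem: "\<bar>\<eta> (z - h) - \<eta> z + (\<Sum>l\<in>UNIV. d l z * h $ l)\<bar> \<le> norm h * (CARD('n) * e')" if h: "norm h < \<delta>" for z h
  proof -
    have "norm (\<eta> (z - h) - \<eta> z - (\<Sum>l\<in>UNIV. d l z * ((z - h) - z) $ l)) \<le> norm ((z - h) - z) * (CARD('n) * e')"
    proof (rule differentiable_bound_linearization[where S="ball z \<delta>" and f'="\<lambda>z h. \<Sum>l\<in>UNIV. d l z * h $ l"])
      show "z + t *\<^sub>R (z - h - z) \<in> ball z \<delta>" if "t \<in> {0..1}" for t
      proof -
        have "\<bar>t\<bar> * norm h \<le> 1 * norm h" using that by (intro mult_right_mono) auto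
        then show ?thesis using h by (simp add: dist_norm)
      qed
      show "(\<eta> has_derivative (\<lambda>h. \<Sum>l\<in>UNIV. d l y * h $ l)) (at y within ball z \<delta>)" for y
        using der by (rule has_derivative_at_withinI)
      show "onorm ((\<lambda>h. \<Sum>l\<in>UNIV. d l y * h $ l) - (\<lambda>h. \<Sum>l\<in>UNIV. d l z * h $ l)) \<le> CARD('n) * e'" if "y \<in> ball z \<delta>" for y
      proof (rule onorm_le)
        fix v :: "real^'n"
        have "norm (((\<lambda>h. \<Sum>l\<in>UNIV. d l y * h $ l) - (\<lambda>h. \<Sum>l\<in>UNIV. d l z * h $ l)) v) = \<bar>\<Sum>l\<in>UNIV. (d l y - d l z) * v $ l\<bar>"
          by (simp add: sum_subtractf left_diff_distrib)
        also have "\<dots> \<le> (\<Sum>l\<in>UNIV. \<bar>d l y - d l z\<bar> * \<bar>v $ l\<bar>)"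
          by (rule order.trans[OF sum_abs]) (simp add: abs_mult)
        also have "\<dots> \<le> (\<Sum>l\<in>(UNIV::'n set). e' * norm v)"
          using close[of y z] that \<open>e' > 0\<close>
          by (intro sum_mono mult_mono component_le_norm_cart) (auto simp: dist_commute)
        finally show "norm (((\<lambda>h. \<Sum>l\<in>UNIV. d l y * h $ l) - (\<lambda>h. \<Sum>l\<in>UNIV. d l z * h $ l)) v) \<le> CARD('n) * e' * norm v"
          by simp
      qed
    qed (use \<open>\<delta> > 0\<close> in auto)
    then show ?thesis by (simp add: sum_negf)
  qed
  show "\<exists>\<delta>>0. \<forall>x'. norm (x' - x) < \<delta> \<longrightarrow>
      norm ((\<integral>y. g y * \<eta> (y - x') \<partial>lborel) - (\<integral>y. g y * \<eta> (y - x) \<partial>lborel)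
        - (\<Sum>l\<in>UNIV. - (\<integral>y. g y * d l (y - x) \<partial>lborel) * (x' - x) $ l)) \<le> e * norm (x' - x)"
  proof (intro exI[of _ \<delta>] conjI allI impI)
    fix x' assume x': "norm (x' - x) < \<delta>"
    define h where "h = x' - x"
    have x'_eq: "y - x' = (y - x) - h" for y by (simp add: h_def)
    let ?r = "\<lambda>y. \<eta> (y - x') - \<eta> (y - x) + (\<Sum>l\<in>UNIV. d l (y - x) * h $ l)"
    note i = integrable_convolution[OF g contE \<eta>] integrable_convolution[OF g d]
    have gr: "g y * ?r y = g y * \<eta> (y - x') - g y * \<eta> (y - x) + (\<Sum>l\<in>UNIV. g y * d l (y - x) * h $ l)" for y
      by (simp add: algebra_simps sum_distrib_left)
    have ir: "integrable lborel (\<lambda>y. g y * ?r y)"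
      unfolding gr using i by auto
    have "(\<integral>y. g y * ?r y \<partial>lborel) = (\<integral>y. g y * \<eta> (y - x') \<partial>lborel) - (\<integral>y. g y * \<eta> (y - x) \<partial>lborel)
        - (\<Sum>l\<in>UNIV. - (\<integral>y. g y * d l (y - x) \<partial>lborel) * h $ l)"
      unfolding gr using i
      by (simp add: Bochner_Integration.integral_add Bochner_Integration.integral_diff
          Bochner_Integration.integral_sum sum_negf)
    moreover have "\<bar>\<integral>y. g y * ?r y \<partial>lborel\<bar> \<le> (\<integral>y. \<bar>g y\<bar> * (norm h * (CARD('n) * e')) \<partial>lborel)"
    proof (rule order.trans[OF integral_abs_bound integral_mono])
      show "\<bar>g y * ?r y\<bar> \<le> \<bar>g y\<bar> * (norm h * (CARD('n) * e'))" for y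
        unfolding abs_mult x'_eq using rem[of h "y - x"] x' by (intro mult_left_mono) (auto simp: h_def)
    qed (use ir g in auto)
    moreover have "(\<integral>y. \<bar>g y\<bar> * (norm h * (CARD('n) * e')) \<partial>lborel) = (G * CARD('n) * e') * norm h"
      unfolding G_def by simp
    moreover have "G * CARD('n) * e' \<le> (G + 1) * CARD('n) * e'"
      using \<open>e' > 0\<close> by (simp add: algebra_simps)
    then have "G * CARD('n) * e' \<le> e"
      using \<open>G \<ge> 0\<close> by (simp add: e'_def)
    then have "(G * CARD('n) * e') * norm h \<le> e * norm h" by (rule mult_right_mono) simp
    ultimately show "norm ((\<integral>y. g y * \<eta> (y - x') \<partial>lborel) - (\<integral>y. g y * \<eta> (y - x) \<partial>lborel)
        - (\<Sum>l\<in>UNIV. - (\<integral>y. g y * d l (y - x) \<partial>lborel) * (x' - x) $ l)) \<le> e * norm (x' - x)"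
      unfolding h_def[symmetric] real_norm_def by linarith
  qed (rule \<open>\<delta> > 0\<close>)
qed

text \<open>The bridge between the two measures: the theorem and \<open>weak_jacobian\<close>
  integrate over \<open>lebesgue\<close>, while translation and Tonelli are carried out on
  \<open>lborel\<close>.\<close>

lemma lebesgue_integral_AE_borel:
  fixes f g :: "real^'n \<Rightarrow> real"
  assumes f: "f \<in> borel_measurable borel" and eq: "AE x in lborel. f x = g x"
  shows "integrable lebesgue g \<longleftrightarrow> integrable lborel f" "integral\<^sup>L lebesgue g = integral\<^sup>L lborel f"
proof -
  have f': "f \<in> borel_measurable lborel" using f by simp
  have fl: "f \<in> borel_measurable lebesgue" using f' by (rule measurable_completion)
  have eq': "AE x in lebesgue. f x = g x" using eq by (rule AE_completion)
  have gl: "g \<in> borel_measurable lebesgue" by (rule borel_measurable_AE[OF fl eq'])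
  show "integrable lebesgue g \<longleftrightarrow> integrable lborel f"
    using integrable_cong_AE[OF fl gl eq'] integrable_completion[OF f'] by simp
  show "integral\<^sup>L lebesgue g = integral\<^sup>L lborel f"
    using integral_cong_AE[OF fl gl eq'] integral_completion[OF f'] by simp
qed

lemma bump_nonneg: "0 \<le> bump e z"
  by (simp add: bump_def flat_nonneg)

lemma integral_bump_pos:
  assumes "0 < e"
  shows "0 < (\<integral>z. bump e (z::real^'n) \<partial>lborel)"
proof (rule ccontr)
  have int: "integrable lborel (bump e :: real^'n \<Rightarrow> real)"
    by (rule integrable_compact_support[OF continuous_bump(1) compact_cball bump_outside(1)[OF assms]])
  assume "\<not> ?thesis"
  then have "(\<integral>z. bump e (z::real^'n) \<partial>lborel) = 0"
    by (intro antisym Bochner_Integration.integral_nonneg) (auto simp: bump_nonneg)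
  then have "AE z in lborel. bump e (z::real^'n) = 0"
    using integral_nonneg_eq_0_iff_AE[OF int] by (simp add: bump_nonneg)
  then have "AE z in lborel. (z::real^'n) \<notin> ball 0 e"
  proof eventually_elim
    case (elim z)
    show ?case
    proof
      assume "z \<in> ball 0 e"
      then have "z \<bullet> z < e\<^sup>2" by (simp add: dot_square_norm power_strict_mono)
      with elim show False by (simp add: bump_def flat_exp_def)
    qed
  qed
  then have "emeasure lborel (ball (0::real^'n) e) = 0"
    by (subst (asm) AE_iff_measurable[OF _ refl]) (auto simp: ball_def)
  then have "measure lborel (ball (0::real^'n) e) = 0" by (simp add: measure_def)
  with content_ball_pos[OF assms, of "0::real^'n"] show False by simp
qed

definition mollifier :: "real \<Rightarrow> real^'n \<Rightarrow> real" where
  "mollifier e z = bump e z / (\<integral>z. bump e (z::real^'n) \<partial>lborel)"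

text \<open>Evaluating the kernel at \<open>y - x\<close> makes it, as a function of y, a multiple
  of the test function from \<open>test_fun_bump\<close>. Since \<open>bump e\<close> is even, this
  is the usual convolution.\<close>

definition mollify :: "real \<Rightarrow> (real^'n \<Rightarrow> real) \<Rightarrow> real^'n \<Rightarrow> real" where
  "mollify e g x = (\<integral>y. g y * mollifier e (y - x) \<partial>lborel)"

text \<open>Stated for all sufficiently small radii so that the finitely many components of F and DF
  can later share a single radius.\<close>

lemma mollify_Lp_approximation:
  fixes g :: "real^'n \<Rightarrow> real"
  assumes g: "g \<in> borel_measurable borel" and p: "1 \<le> p"
    and int: "integrable lborel (\<lambda>x. \<bar>g x\<bar> ^ p)" and \<epsilon>: "0 < \<epsilon>"
  shows "eventually (\<lambda>e. integrable lborel (\<lambda>x. \<bar>mollify e g x - g x\<bar> ^ p) \<and>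
    (\<integral>x. \<bar>mollify e g x - g x\<bar> ^ p \<partial>lborel) \<le> \<epsilon>) (at_right 0)"
proof -
  have "eventually (\<lambda>h. dist (\<integral>x. \<bar>g (h + x) - g x\<bar> ^ p \<partial>lborel) 0 < \<epsilon>) (at 0)"
    by (rule tendstoD[OF Lp_translation_continuous[OF g p int] \<epsilon>])
  then obtain d where d: "0 < d" "\<And>h. h \<noteq> 0 \<Longrightarrow> norm h < d \<Longrightarrow> (\<integral>x. \<bar>g (h + x) - g x\<bar> ^ p \<partial>lborel) < \<epsilon>"
    unfolding eventually_at by (auto simp: dist_norm)
  \<comment> \<open>The limit at 0 says nothing about h = 0; there the integrand is 0^p, which is 0
    because p \<ge> 1.\<close>
  have small: "(\<integral>x. \<bar>g (h + x) - g x\<bar> ^ p \<partial>lborel) \<le> \<epsilon>" if "norm h < d" for h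
    using d(2)[of h] that p \<epsilon> by (cases "h = 0") (auto simp: power_0_left)
  have "integrable lborel (\<lambda>x. \<bar>mollify e g x - g x\<bar> ^ p) \<and>
      (\<integral>x. \<bar>mollify e g x - g x\<bar> ^ p \<partial>lborel) \<le> \<epsilon>" if e: "0 < e" "e < d" for e
  proof -
    let ?c = "\<integral>z. bump e (z::real^'n) \<partial>lborel"
    have c: "0 < ?c" by (rule integral_bump_pos[OF e(1)])
    have cont: "continuous_on UNIV (mollifier e :: real^'n \<Rightarrow> real)"
      unfolding mollifier_def[abs_def] using c by (intro continuous_intros continuous_bump) simp
    have out: "mollifier e z = 0" if "z \<notin> cball 0 e" for z :: "real^'n"
      using bump_outside(1)[OF e(1) that] by (simp add: mollifier_def)
    obtain M where M: "\<And>z::real^'n. \<bar>mollifier e z\<bar> \<le> M"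
      using bounded_compact_support[OF cont compact_cball out] by blast
    have meas: "mollifier e \<in> borel_measurable (borel :: (real^'n) measure)"
      by (rule borel_measurable_continuous_onI[OF cont])
    have m_int: "integrable lborel (mollifier e :: real^'n \<Rightarrow> real)"
      by (rule integrable_compact_support[OF cont compact_cball out])
    have m_one: "(\<integral>z. mollifier e (z::real^'n) \<partial>lborel) = 1"
      unfolding mollifier_def using c by simp
    have m_nonneg: "0 \<le> mollifier e z" for z :: "real^'n"
      unfolding mollifier_def using c by (simp add: bump_nonneg)
    have m_le: "mollifier e z \<le> M" for z :: "real^'n"
      using M[of z] by simp
    have m_err: "(\<integral>x. \<bar>g (z + x) - g x\<bar> ^ p \<partial>lborel) \<le> \<epsilon>" if "mollifier e z \<noteq> 0" for z
      using out[of z] that e by (intro small) force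
    note mollification_Lp_error[OF g meas p int m_int m_one m_nonneg m_le m_err less_imp_le[OF \<epsilon>]]
    then show ?thesis by (simp add: mollify_def)
  qed
  then show ?thesis
    unfolding eventually_at_right_field using d(1) by blast
qed

section \<open>Growth bounds\<close>

lemma sum_power_le:
  fixes a :: "'i \<Rightarrow> real"
  assumes I: "finite I" "I \<noteq> {}" and a: "\<And>i. i \<in> I \<Longrightarrow> 0 \<le> a i"
  shows "(\<Sum>i\<in>I. a i) ^ p \<le> real (card I) ^ p * (\<Sum>i\<in>I. a i ^ p)"
proof -
  have "Max (a ` I) \<in> a ` I" using I by (intro Max_in) auto
  then obtain k where k: "k \<in> I" "Max (a ` I) = a k" by auto
  have "a i \<le> a k" if "i \<in> I" for i
    using Max_ge[of "a ` I" "a i"] I that k by simp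
  then have "(\<Sum>i\<in>I. a i) \<le> card I * a k"
    by (rule sum_bounded_above)
  then have "(\<Sum>i\<in>I. a i) ^ p \<le> (card I * a k) ^ p"
    by (intro power_mono sum_nonneg a)
  also have "\<dots> = real (card I) ^ p * a k ^ p" by (simp add: power_mult_distrib)
  also have "\<dots> \<le> real (card I) ^ p * (\<Sum>i\<in>I. a i ^ p)"
    using I k a by (intro mult_left_mono member_le_sum) auto
  finally show ?thesis .
qed

lemma prod_le_sum_power:
  fixes a :: "'i \<Rightarrow> real"
  assumes I: "finite I" "I \<noteq> {}" and a: "\<And>i. i \<in> I \<Longrightarrow> 0 \<le> a i"
  shows "(\<Prod>i\<in>I. a i) \<le> (\<Sum>i\<in>I. a i ^ card I)"
proof -
  have "Max (a ` I) \<in> a ` I" using I by (intro Max_in) auto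
  then obtain k where k: "k \<in> I" "Max (a ` I) = a k" by auto
  have "a i \<le> a k" if "i \<in> I" for i
    using Max_ge[of "a ` I" "a i"] I that k by simp
  then have "(\<Prod>i\<in>I. a i) \<le> (\<Prod>i\<in>I. a k)"
    using a by (intro prod_mono) auto
  also have "\<dots> = a k ^ card I" by simp
  also have "\<dots> \<le> (\<Sum>i\<in>I. a i ^ card I)"
    using I k a by (intro member_le_sum) auto
  finally show ?thesis .
qed

text \<open>Each of the n! Leibniz terms is a product of n entries, hence at most the n-th power of
  the largest, and that power is one summand on the right.\<close>

lemma abs_det_le:
  fixes B :: "real^'n^'n"
  shows "\<bar>det B\<bar> \<le> fact CARD('n) * (\<Sum>k\<in>UNIV. \<Sum>l\<in>UNIV. \<bar>B $ k $ l\<bar> ^ CARD('n))"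
proof -
  let ?S = "\<Sum>k\<in>UNIV. \<Sum>l\<in>UNIV. \<bar>B $ k $ l\<bar> ^ CARD('n)"
  have "\<bar>of_int (sign p) * (\<Prod>k\<in>UNIV. B $ k $ p k)\<bar> \<le> ?S" for p
  proof -
    have "\<bar>of_int (sign p) * (\<Prod>k\<in>UNIV. B $ k $ p k)\<bar> = (\<Prod>k\<in>UNIV. \<bar>B $ k $ p k\<bar>)"
      by (simp add: abs_mult abs_prod sign_def)
    also have "\<dots> \<le> (\<Sum>k\<in>UNIV. \<bar>B $ k $ p k\<bar> ^ CARD('n))"
      by (rule prod_le_sum_power) auto
    also have "\<dots> \<le> ?S"
      by (intro sum_mono member_le_sum) auto
    finally show ?thesis .
  qed
  then have "\<bar>det B\<bar> \<le> (\<Sum>p | p permutes (UNIV::'n set). ?S)"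
    unfolding det_def by (intro order.trans[OF sum_abs] sum_mono)
  then show ?thesis by (simp add: card_permutations)
qed

lemma tendsto_det:
  fixes A :: "'a \<Rightarrow> real^'n^'n"
  assumes "\<And>i j. ((\<lambda>x. A x $ i $ j) \<longlongrightarrow> B $ i $ j) F"
  shows "((\<lambda>x. det (A x)) \<longlongrightarrow> det B) F"
  unfolding det_def by (intro tendsto_intros assms)

lemma borel_measurable_det:
  fixes A :: "'a \<Rightarrow> real^'n^'n"
  assumes "\<And>i j. (\<lambda>x. A x $ i $ j) \<in> borel_measurable M"
  shows "(\<lambda>x. det (A x)) \<in> borel_measurable M"
  unfolding det_def by (intro borel_measurable_sum borel_measurable_times borel_measurable_prod borel_measurable_const assms)

lemma tendsto_adj:
  fixes A :: "'a \<Rightarrow> real^'n^'n"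
  assumes "\<And>i j. ((\<lambda>x. A x $ i $ j) \<longlongrightarrow> B $ i $ j) F"
  shows "((\<lambda>x. adj (A x) $ i $ j) \<longlongrightarrow> adj B $ i $ j) F"
  unfolding adj_nth by (rule tendsto_det) (simp add: assms)

lemma borel_measurable_adj:
  fixes A :: "'a \<Rightarrow> real^'n^'n"
  assumes "\<And>i j. (\<lambda>x. A x $ i $ j) \<in> borel_measurable M"
  shows "(\<lambda>x. adj (A x) $ i $ j) \<in> borel_measurable M"
  unfolding adj_nth
proof (rule borel_measurable_det)
  show "(\<lambda>x. (\<chi> r. if r = j then axis i 1 else A x $ r) $ a $ b) \<in> borel_measurable M" for a b
    using assms by (cases "a = j") auto
qed

text \<open>The n-th power of the entrywise l^n norm of the pair. With no root taken, its
  integrability is exactly that of the components, and it serves both to measure mollification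
  errors and to dominate the integrands.\<close>

definition power_norm :: "real^'n \<Rightarrow> real^'n^'n \<Rightarrow> real" where
  "power_norm w A = (\<Sum>i\<in>UNIV. \<bar>w $ i\<bar> ^ CARD('n)) + (\<Sum>i\<in>UNIV. \<Sum>j\<in>UNIV. \<bar>A $ i $ j\<bar> ^ CARD('n))"

lemma power_norm_nonneg: "0 \<le> power_norm w A"
  by (auto simp: power_norm_def intro!: add_nonneg_nonneg sum_nonneg)

lemma power_norm_add_le: "power_norm (w + w') (A + A') \<le> 2 ^ CARD('n) * (power_norm w A + power_norm w' A')"
  for w :: "real^'n"
proof -
  have le: "\<bar>a + b\<bar> ^ CARD('n) \<le> 2 ^ CARD('n) * (\<bar>a\<bar> ^ CARD('n) + \<bar>b\<bar> ^ CARD('n))" for a b :: real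
    by (rule order.trans[OF power_mono[OF abs_triangle_ineq] power_add_le]) auto
  have "power_norm (w + w') (A + A') \<le> (\<Sum>i\<in>UNIV. 2 ^ CARD('n) * (\<bar>w $ i\<bar> ^ CARD('n) + \<bar>w' $ i\<bar> ^ CARD('n)))
    + (\<Sum>i\<in>UNIV. \<Sum>j\<in>UNIV. 2 ^ CARD('n) * (\<bar>A $ i $ j\<bar> ^ CARD('n) + \<bar>A' $ i $ j\<bar> ^ CARD('n)))"
    unfolding power_norm_def by (intro add_mono sum_mono) (auto intro: le)
  also have "\<dots> = 2 ^ CARD('n) * (power_norm w A + power_norm w' A')"
    unfolding power_norm_def
    by (simp add: sum_distrib_left[symmetric] sum.distrib algebra_simps)
  finally show ?thesis .
qed

text \<open>The factor \<open>V w $ j\<close> is absorbed into row j of the cofactor determinant.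
  The product is then a single determinant, and \<open>abs_det_le\<close> replaces a separate
  treatment of the degrees n - 1 and 1.\<close>

lemma adj_mult_growth:
  fixes V :: "real^'n \<Rightarrow> real^'n"
  assumes L: "\<And>w. norm (V w) \<le> L * (1 + norm w)"
  shows "\<exists>C\<ge>0. \<forall>A w i j. \<bar>adj A $ i $ j * V w $ j\<bar> \<le> C * (1 + power_norm w A)"
proof -
  let ?n = "CARD('n)"
  have L0: "0 \<le> L" using order.trans[OF norm_ge_zero L[of 0]] by simp
  \<comment> \<open>L^n comes from the growth of V, 2^n from separating 1 from the norm of w, and
    n^n from the power of a sum over n components.\<close>
  let ?c = "L ^ ?n * (2 ^ ?n * real ?n ^ ?n)"
  have c0: "0 \<le> ?c" using L0 by simp
  have V: "\<bar>V w $ j\<bar> ^ ?n \<le> ?c * (1 + (\<Sum>i\<in>UNIV. \<bar>w $ i\<bar> ^ ?n))" for w j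
  proof -
    have "\<bar>V w $ j\<bar> \<le> L * (1 + (\<Sum>i\<in>UNIV. \<bar>w $ i\<bar>))"
      using component_le_norm_cart[of "V w" j] L[of w] mult_left_mono[OF norm_le_l1_cart[of w] L0]
      by (simp add: algebra_simps)
    then have "\<bar>V w $ j\<bar> ^ ?n \<le> (L * (1 + (\<Sum>i\<in>UNIV. \<bar>w $ i\<bar>))) ^ ?n"
      by (intro power_mono) auto
    also have "\<dots> = L ^ ?n * (1 + (\<Sum>i\<in>UNIV. \<bar>w $ i\<bar>)) ^ ?n"
      by (simp add: power_mult_distrib)
    also have "\<dots> \<le> L ^ ?n * (2 ^ ?n * (1 ^ ?n + (\<Sum>i\<in>UNIV. \<bar>w $ i\<bar>) ^ ?n))"
      using L0 by (intro mult_left_mono power_add_le sum_nonneg) auto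
    also have "\<dots> \<le> L ^ ?n * (2 ^ ?n * (real ?n ^ ?n * (1 + (\<Sum>i\<in>UNIV. \<bar>w $ i\<bar> ^ ?n))))"
    proof -
      have "(1::real) \<le> real ?n ^ ?n" by (intro one_le_power) simp
      moreover have "(\<Sum>i\<in>UNIV. \<bar>w $ i\<bar>) ^ ?n \<le> real ?n ^ ?n * (\<Sum>i\<in>UNIV. \<bar>w $ i\<bar> ^ ?n)"
        by (rule sum_power_le) auto
      ultimately show ?thesis
        using L0 by (intro mult_left_mono) (simp_all only: distrib_left mult_1_right power_one add_mono zero_le_power zero_le_numeral)
    qed
    finally show ?thesis by (simp add: mult.assoc)
  qed
  have "\<bar>adj A $ i $ j * V w $ j\<bar> \<le> fact ?n * (1 + ?c) * (1 + power_norm w A)" for A w i j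
  proof -
    let ?B = "\<chi> r. if r = j then V w $ j *s axis i 1 else A $ r"
    have "adj A $ i $ j * V w $ j = det ?B"
      unfolding adj_nth using det_row_mul[of j "V w $ j" "\<lambda>_. axis i 1" "\<lambda>r. A $ r"] by simp
    then have "\<bar>adj A $ i $ j * V w $ j\<bar> \<le> fact ?n * (\<Sum>k\<in>UNIV. \<Sum>l\<in>UNIV. \<bar>?B $ k $ l\<bar> ^ ?n)"
      using abs_det_le[of ?B] by simp
    \<comment> \<open>Row j of \<open>?B\<close> is zero except possibly for \<open>V w $ j\<close>
      in column i; adding the powers of row j of A only enlarges the bound and completes the sum
      over A.\<close>
    also have "(\<Sum>k\<in>UNIV. \<Sum>l\<in>UNIV. \<bar>?B $ k $ l\<bar> ^ ?n)
      \<le> (\<Sum>k\<in>UNIV. \<Sum>l\<in>UNIV. \<bar>A $ k $ l\<bar> ^ ?n + (if k = j then if l = i then \<bar>V w $ j\<bar> ^ ?n else 0 else 0))"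
      by (intro sum_mono) (auto simp: axis_def abs_mult power_0_left)
    also have "\<dots> = (\<Sum>k\<in>UNIV. \<Sum>l\<in>UNIV. \<bar>A $ k $ l\<bar> ^ ?n) + \<bar>V w $ j\<bar> ^ ?n"
    proof -
      have "(\<Sum>l\<in>UNIV. if k = j then if l = i then \<bar>V w $ j\<bar> ^ ?n else 0 else 0) = (if k = j then \<bar>V w $ j\<bar> ^ ?n else 0)" for k
        by simp
      then show ?thesis by (simp add: sum.distrib)
    qed
    also have "\<dots> \<le> (1 + ?c) * (1 + power_norm w A)"
    proof -
      let ?a = "\<Sum>k\<in>UNIV. \<Sum>l\<in>UNIV. \<bar>A $ k $ l\<bar> ^ ?n" and ?b = "\<Sum>i\<in>UNIV. \<bar>w $ i\<bar> ^ ?n"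
      have "0 \<le> ?a" "0 \<le> ?b" by (auto intro!: sum_nonneg)
      then have "?a + ?c * (1 + ?b) \<le> (1 + ?c) * (1 + (?b + ?a))"
        using mult_nonneg_nonneg[OF c0 \<open>0 \<le> ?a\<close>] by (simp add: algebra_simps)
      then show ?thesis using V[of w j] by (simp add: power_norm_def)
    qed
    finally show ?thesis by (simp add: mult.assoc)
  qed
  then show ?thesis
    using c0 by (intro exI[of _ "fact ?n * (1 + ?c)"]) auto
qed

section \<open>Passage to the limit\<close>

lemma borel_measurable_mollify:
  fixes g :: "real^'n \<Rightarrow> real"
  assumes [measurable]: "g \<in> borel_measurable borel"
  shows "mollify e g \<in> borel_measurable borel"
proof -
  have [measurable]: "bump e \<in> borel_measurable (borel :: (real^'n) measure)"
    by (rule borel_measurable_continuous_onI[OF continuous_bump(1)])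
  show ?thesis
    unfolding mollify_def[abs_def] mollifier_def by measurable
qed

text \<open>Two differentiations under the integral, each landing on the kernel with a change of
  sign. The normalising constant c is displayed because \<open>bump1\<close> and
  \<open>bump2\<close> are derivatives of the unnormalised bump.\<close>

lemma has_derivative_mollify:
  fixes g :: "real^'n \<Rightarrow> real"
  assumes g: "integrable lborel g" and e: "0 < e"
  defines "c \<equiv> \<integral>z. bump e (z::real^'n) \<partial>lborel"
  shows "(mollify e g has_derivative
      (\<lambda>h. \<Sum>l\<in>UNIV. - (\<integral>y. g y * (bump1 e l (y - x) / c) \<partial>lborel) * h $ l)) (at x)"
    and "((\<lambda>x. \<integral>y. g y * (bump1 e j (y - x) / c) \<partial>lborel) has_derivative
      (\<lambda>h. \<Sum>l\<in>UNIV. - (\<integral>y. g y * (bump2 e j l (y - x) / c) \<partial>lborel) * h $ l)) (at x)"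
    and "continuous_on UNIV (\<lambda>x. \<integral>y. g y * (bump2 e j l (y - x) / c) \<partial>lborel)"
proof -
  have c: "c \<noteq> 0" using integral_bump_pos[OF e, where 'n='n] by (simp add: c_def)
  have der: "((\<lambda>z. \<eta> z / c) has_derivative (\<lambda>h. \<Sum>l\<in>UNIV. (d l z / c) * h $ l)) (at z)"
    if "(\<eta> has_derivative (\<lambda>h. \<Sum>l\<in>UNIV. d l z * h $ l)) (at z)" for \<eta> :: "real^'n \<Rightarrow> real" and d z
    using has_derivative_mult_right[OF that, of "inverse c"]
    by (simp add: sum_distrib_left divide_inverse mult.commute mult.left_commute mult.assoc)
  have der0: "((\<lambda>z. bump e z / c) has_derivative (\<lambda>h. \<Sum>l\<in>UNIV. (bump1 e l z / c) * h $ l)) (at z)" for z :: "real^'n"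
    by (rule der) (rule has_derivative_bump)
  have der1: "((\<lambda>z. bump1 e j z / c) has_derivative (\<lambda>h. \<Sum>l\<in>UNIV. (bump2 e j l z / c) * h $ l)) (at z)" for z :: "real^'n"
    by (rule der) (rule has_derivative_bump1)
  have cont: "continuous_on UNIV (\<lambda>z. \<eta> z / c)" if "continuous_on UNIV \<eta>" for \<eta> :: "real^'n \<Rightarrow> real"
    using that c by (intro continuous_intros) auto
  show "(mollify e g has_derivative
      (\<lambda>h. \<Sum>l\<in>UNIV. - (\<integral>y. g y * (bump1 e l (y - x) / c) \<partial>lborel) * h $ l)) (at x)"
    unfolding mollify_def[abs_def] mollifier_def c_def[symmetric]
    by (rule has_derivative_convolution[OF g der0, where R=e])
      (simp_all add: bump_outside[OF e] cont continuous_bump)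
  show "((\<lambda>x. \<integral>y. g y * (bump1 e j (y - x) / c) \<partial>lborel) has_derivative
      (\<lambda>h. \<Sum>l\<in>UNIV. - (\<integral>y. g y * (bump2 e j l (y - x) / c) \<partial>lborel) * h $ l)) (at x)"
    by (rule has_derivative_convolution[OF g der1, where R=e])
      (simp_all add: bump_outside[OF e] cont continuous_bump)
  show "continuous_on UNIV (\<lambda>x. \<integral>y. g y * (bump2 e j l (y - x) / c) \<partial>lborel)"
    by (rule continuous_on_convolution[OF g cont[OF continuous_bump(3)], where R=e])
      (simp add: bump_outside[OF e])
qed

text \<open>The derivative of W is an integral against \<open>bump1\<close>, and \<open>weak\<close>
  identifies it with B on K alone. Since \<phi> and g vanish off K, the identity for the true
  derivative remains valid with B in its place, even where B is not the derivative of W.\<close>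

lemma divergence_identity_mollified:
  fixes u :: "real^'n \<Rightarrow> real^'n" and v :: "real^'n \<Rightarrow> real^'n^'n"
    and V :: "real^'n \<Rightarrow> real^'n" and DV :: "real^'n \<Rightarrow> real^'n^'n"
  assumes u_int: "\<And>i. integrable lborel (\<lambda>x. u x $ i)" and e: "0 < e"
    and weak: "\<And>x i j. x \<in> K \<Longrightarrow>
      (\<integral>y. u y $ i * bump1 e j (y - x) \<partial>lborel) = - (\<integral>y. v y $ i $ j * bump e (y - x) \<partial>lborel)"
    and V: "\<And>y. (V has_derivative (\<lambda>h. DV y *v h)) (at y)"
    and DV: "continuous_on UNIV DV"
    and \<phi>: "\<And>x. (\<phi> has_derivative (\<lambda>h. g x \<bullet> h)) (at x)"
    and g: "continuous_on UNIV g"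
    and K: "compact K" "\<And>x. x \<notin> K \<Longrightarrow> \<phi> x = 0"
  defines "W \<equiv> \<lambda>x. \<chi> i. mollify e (\<lambda>y. u y $ i) x"
    and "B \<equiv> \<lambda>x. \<chi> i j. mollify e (\<lambda>y. v y $ i $ j) x"
  shows "(\<integral>x. (adj (B x) *v V (W x)) \<bullet> g x \<partial>lborel) = - (\<integral>x. mtrace (DV (W x)) * det (B x) * \<phi> x \<partial>lborel)"
    and "continuous_on UNIV W"
proof -
  define c where "c = (\<integral>z. bump e (z::real^'n) \<partial>lborel)"
  \<comment> \<open>The true derivative of W on the whole space. It carries one minus sign; in the
    second derivative H two of them cancel.\<close>
  define A :: "real^'n \<Rightarrow> real^'n^'n" where
    "A x = (\<chi> i j. - (\<integral>y. u y $ i * (bump1 e j (y - x) / c) \<partial>lborel))" for x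
  define H where "H x i j l = (\<integral>y. u y $ i * (bump2 e j l (y - x) / c) \<partial>lborel)" for x i j l
  note der = has_derivative_mollify[OF u_int e, folded c_def]
  have W_der: "(W has_derivative (\<lambda>h. A x *v h)) (at x)" for x
  proof (subst has_derivative_componentwise_within, rule ballI)
    fix b :: "real^'n" assume "b \<in> Basis"
    then obtain i where b: "b = axis i 1" by (auto simp: Basis_vec_def)
    show "((\<lambda>x. W x \<bullet> b) has_derivative (\<lambda>h. (A x *v h) \<bullet> b)) (at x)"
      using der(1)[of i x] by (simp add: b W_def A_def inner_axis matrix_vector_mult_def)
  qed
  then show "continuous_on UNIV W"
    by (auto intro!: continuous_at_imp_continuous_on intro: has_derivative_continuous)
  have "(\<integral>x. (adj (A x) *v V (W x)) \<bullet> g x \<partial>lborel) = - (\<integral>x. mtrace (DV (W x)) * det (A x) * \<phi> x \<partial>lborel)"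
  proof (rule C2_divergence_identity[where H=H, OF W_der _ _ _ V DV \<phi> g K])
    show "((\<lambda>x. A x $ i $ j) has_derivative (\<lambda>h. \<Sum>l\<in>UNIV. H x i j l * h $ l)) (at x)" for x i j
      using has_derivative_minus[OF der(2)[of i j x]] by (simp add: A_def H_def sum_negf)
    show "continuous_on UNIV (\<lambda>x. H x i j l)" for i j l
      unfolding H_def by (rule der(3))
    show "H x i j l = H x i l j" for x i j l
      unfolding H_def by (simp add: bump2_commute[of e j l])
  qed
  moreover have "A x = B x" if "x \<in> K" for x
    using weak[OF that] by (simp add: A_def B_def vec_eq_iff mollify_def mollifier_def c_def[symmetric])
  moreover have "g x = 0" if "x \<notin> K" for x
    using has_derivative_zero_outside[OF \<phi> compact_imp_closed[OF K(1)] K(2) that] inner_eq_zero_iff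
    by metis
  ultimately have eq: "(adj (A x) *v V (W x)) \<bullet> g x = (adj (B x) *v V (W x)) \<bullet> g x"
    "mtrace (DV (W x)) * det (A x) * \<phi> x = mtrace (DV (W x)) * det (B x) * \<phi> x" for x
    using K(2) by (cases "x \<in> K"; simp)+
  with \<open>(\<integral>x. (adj (A x) *v V (W x)) \<bullet> g x \<partial>lborel) = _\<close>
  show "(\<integral>x. (adj (B x) *v V (W x)) \<bullet> g x \<partial>lborel) = - (\<integral>x. mtrace (DV (W x)) * det (B x) * \<phi> x \<partial>lborel)"
    by simp
qed

text \<open>The hypotheses record what truncation leaves: globally integrable u and v whose weak
  relation is tested only by kernels of radius below \<delta> centred in K.\<close>

lemma weak_divergence_identity:
  fixes u :: "real^'n \<Rightarrow> real^'n" and v :: "real^'n \<Rightarrow> real^'n^'n"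
    and V :: "real^'n \<Rightarrow> real^'n" and DV :: "real^'n \<Rightarrow> real^'n^'n"
  assumes u[measurable]: "u \<in> borel_measurable borel"
    and v[measurable]: "\<And>i j. (\<lambda>x. v x $ i $ j) \<in> borel_measurable borel"
    and u_int: "\<And>i. integrable lborel (\<lambda>x. u x $ i)"
    and u_pow: "\<And>i. integrable lborel (\<lambda>x. \<bar>u x $ i\<bar> ^ CARD('n))"
    and v_pow: "\<And>i j. integrable lborel (\<lambda>x. \<bar>v x $ i $ j\<bar> ^ CARD('n))"
    and \<delta>: "0 < \<delta>"
    and weak: "\<And>e x i j. 0 < e \<Longrightarrow> e < \<delta> \<Longrightarrow> x \<in> K \<Longrightarrow>
      (\<integral>y. u y $ i * bump1 e j (y - x) \<partial>lborel) = - (\<integral>y. v y $ i $ j * bump e (y - x) \<partial>lborel)"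
    and V: "\<And>y. (V has_derivative (\<lambda>h. DV y *v h)) (at y)"
    and DV: "continuous_on UNIV DV"
    and DVbdd: "bounded (range DV)"
    and \<phi>: "\<And>x. (\<phi> has_derivative (\<lambda>h. g x \<bullet> h)) (at x)"
    and g: "continuous_on UNIV g"
    and K: "compact K" "\<And>x. x \<notin> K \<Longrightarrow> \<phi> x = 0"
  shows "integrable lborel (\<lambda>x. (adj (v x) *v V (u x)) \<bullet> g x)"
    and "integrable lborel (\<lambda>x. mtrace (DV (u x)) * det (v x) * \<phi> x)"
    and "(\<integral>x. (adj (v x) *v V (u x)) \<bullet> g x \<partial>lborel) = - (\<integral>x. mtrace (DV (u x)) * det (v x) * \<phi> x \<partial>lborel)"
proof -
  let ?n = "CARD('n)"
  have n: "1 \<le> ?n" by simp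
  have u': "(\<lambda>x. u x $ i) \<in> borel_measurable borel" for i
    using borel_measurable_integrable[OF u_int] by simp
  let ?P = "\<lambda>k e f. integrable lborel (\<lambda>x. \<bar>mollify e f x - f x\<bar> ^ ?n) \<and>
      (\<integral>x. \<bar>mollify e f x - f x\<bar> ^ ?n \<partial>lborel) \<le> (1 / 2) ^ k"
  \<comment> \<open>One radius per k controls every component of u and v, with geometrically
    decreasing errors.\<close>
  define good where "good k e \<longleftrightarrow> 0 < e \<and> e < \<delta> \<and>
      (\<forall>i. ?P k e (\<lambda>x. u x $ i)) \<and> (\<forall>i j. ?P k e (\<lambda>x. v x $ i $ j))" for k e
  have "\<exists>e. good k e" for k
  proof -
    have "eventually (good k) (at_right 0)"
      unfolding good_def using \<delta>
      by (intro eventually_conj eventually_all_finite mollify_Lp_approximation u' v n u_pow v_pow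
          eventually_at_right_less eventually_at_rightI[of 0 \<delta>]) auto
    then show ?thesis by (rule eventually_happens'[OF trivial_limit_at_right_real])
  qed
  then obtain e where good: "good k (e k)" for k by metis
  have e: "0 < e k" "e k < \<delta>" "?P k (e k) (\<lambda>x. u x $ i)" "?P k (e k) (\<lambda>x. v x $ i $ j)" for k i j
    using good[of k] unfolding good_def by auto
  define W where "W k x = (\<chi> i. mollify (e k) (\<lambda>y. u y $ i) x)" for k x
  define B where "B k x = (\<chi> i j. mollify (e k) (\<lambda>y. v y $ i $ j) x)" for k x
  have ident: "(\<integral>x. (adj (B k x) *v V (W k x)) \<bullet> g x \<partial>lborel)
      = - (\<integral>x. mtrace (DV (W k x)) * det (B k x) * \<phi> x \<partial>lborel)"
    and contW: "continuous_on UNIV (W k)" for k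
  proof -
    note divergence_identity_mollified[OF u_int e(1)[of k] weak[OF e(1,2)[of k]] V DV \<phi> g K]
    then show "(\<integral>x. (adj (B k x) *v V (W k x)) \<bullet> g x \<partial>lborel)
      = - (\<integral>x. mtrace (DV (W k x)) * det (B k x) * \<phi> x \<partial>lborel)" "continuous_on UNIV (W k)"
      unfolding W_def[abs_def] B_def by auto
  qed
  have [measurable]: "W k \<in> borel_measurable borel" for k
    by (rule borel_measurable_continuous_onI[OF contW])
  have [measurable]: "(\<lambda>x. B k x $ i $ j) \<in> borel_measurable borel" for k i j
    using borel_measurable_mollify[OF v[of i j]] by (simp add: B_def)
  \<comment> \<open>Collecting all component errors in one scalar lets a single choice of indices
    and a single dominating function serve every component.\<close>
  define S where "S k x = power_norm (W k x - u x) (B k x - v x)" for k x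
  have S_eq: "S k x = (\<Sum>i\<in>UNIV. \<bar>mollify (e k) (\<lambda>y. u y $ i) x - u x $ i\<bar> ^ ?n)
      + (\<Sum>i\<in>UNIV. \<Sum>j\<in>UNIV. \<bar>mollify (e k) (\<lambda>y. v y $ i $ j) x - v x $ i $ j\<bar> ^ ?n)" for k x
    by (simp add: S_def power_norm_def W_def B_def)
  have S_int: "integrable lborel (S k)" for k
    unfolding S_eq using e(3,4) by (intro Bochner_Integration.integrable_add Bochner_Integration.integrable_sum) auto
  have S_le: "(\<integral>x. S k x \<partial>lborel) \<le> (real ?n + real ?n * real ?n) * (1 / 2) ^ k" for k
  proof -
    have "(\<integral>x. S k x \<partial>lborel) = (\<Sum>i\<in>UNIV. \<integral>x. \<bar>mollify (e k) (\<lambda>y. u y $ i) x - u x $ i\<bar> ^ ?n \<partial>lborel)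
      + (\<Sum>i\<in>UNIV. \<Sum>j\<in>UNIV. \<integral>x. \<bar>mollify (e k) (\<lambda>y. v y $ i $ j) x - v x $ i $ j\<bar> ^ ?n \<partial>lborel)"
      unfolding S_eq using e(3,4)
      by (simp add: Bochner_Integration.integral_add Bochner_Integration.integral_sum)
    also have "\<dots> \<le> (\<Sum>i\<in>(UNIV::'n set). (1 / 2) ^ k) + (\<Sum>i\<in>(UNIV::'n set). \<Sum>j\<in>(UNIV::'n set). (1 / 2) ^ k)"
      using e(3,4) by (intro add_mono sum_mono) auto
    also have "\<dots> = (real ?n + real ?n * real ?n) * (1 / 2) ^ k" by (simp add: algebra_simps)
    finally show ?thesis .
  qed
  have S_nonneg: "0 \<le> S k x" for k x
    by (simp add: S_def power_norm_nonneg)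
  have geometric: "(\<lambda>k. (real ?n + real ?n * real ?n) * (1 / 2) ^ k) \<longlonglongrightarrow> 0"
    by (intro tendsto_mult_right_zero LIMSEQ_realpow_zero) auto
  have "(\<lambda>k. \<integral>x. S k x \<partial>lborel) \<longlonglongrightarrow> 0"
    by (rule tendsto_sandwich[OF _ _ tendsto_const geometric])
      (auto intro!: always_eventually S_le Bochner_Integration.integral_nonneg S_nonneg)
  then obtain r h where h: "integrable lborel h" and S_lim: "AE x in lborel. (\<lambda>k. S (r k) x) \<longlonglongrightarrow> 0"
      and S_h: "AE x in lborel. \<forall>k. S (r k) x \<le> h x"
    by (rule summable_subsequence_dominated[OF S_int S_nonneg])
  \<comment> \<open>S controls n-th powers of the errors; continuity of the n-th root recovers
    convergence of the components themselves.\<close>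
  have lim_component: "a \<longlonglongrightarrow> b" if "\<And>k. \<bar>a k - b\<bar> ^ ?n \<le> S (r k) x" "(\<lambda>k. S (r k) x) \<longlonglongrightarrow> 0"
    for a :: "nat \<Rightarrow> real" and b x
  proof -
    have "(\<lambda>k. \<bar>a k - b\<bar> ^ ?n) \<longlonglongrightarrow> 0"
      by (rule tendsto_sandwich[OF _ _ tendsto_const that(2)]) (use that(1) in auto)
    then have "(\<lambda>k. root ?n (\<bar>a k - b\<bar> ^ ?n)) \<longlonglongrightarrow> root ?n 0"
      by (rule tendsto_real_root)
    then show ?thesis
      by (simp add: real_root_power_cancel tendsto_rabs_zero_iff LIM_zero_iff)
  qed
  have S_ge: "\<bar>W k x $ i - u x $ i\<bar> ^ ?n \<le> S k x" "\<bar>B k x $ i $ j - v x $ i $ j\<bar> ^ ?n \<le> S k x" for k x i j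
  proof -
    have 1: "0 \<le> (\<Sum>i\<in>UNIV. \<bar>(W k x - u x) $ i\<bar> ^ ?n)" "0 \<le> (\<Sum>i\<in>UNIV. \<Sum>j\<in>UNIV. \<bar>(B k x - v x) $ i $ j\<bar> ^ ?n)"
      by (auto intro!: sum_nonneg)
    have "\<bar>(W k x - u x) $ i\<bar> ^ ?n \<le> (\<Sum>i\<in>UNIV. \<bar>(W k x - u x) $ i\<bar> ^ ?n)"
      by (rule member_le_sum) auto
    then show "\<bar>W k x $ i - u x $ i\<bar> ^ ?n \<le> S k x"
      using 1 by (simp add: S_def power_norm_def)
    have "\<bar>(B k x - v x) $ i $ j\<bar> ^ ?n \<le> (\<Sum>j\<in>UNIV. \<bar>(B k x - v x) $ i $ j\<bar> ^ ?n)"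
      by (rule member_le_sum) auto
    also have "\<dots> \<le> (\<Sum>i\<in>UNIV. \<Sum>j\<in>UNIV. \<bar>(B k x - v x) $ i $ j\<bar> ^ ?n)"
      by (rule member_le_sum) (auto intro!: sum_nonneg)
    finally show "\<bar>B k x $ i $ j - v x $ i $ j\<bar> ^ ?n \<le> S k x"
      using 1 by (simp add: S_def power_norm_def)
  qed
  have pn_int: "integrable lborel (\<lambda>x. power_norm (u x) (v x))"
    unfolding power_norm_def using u_pow v_pow by auto
  \<comment> \<open>Proved for a general integrand Q so that both sides of the identity share the
    limit argument. The bound uses the indicator of K rather than 1, since constants are not
    integrable over the whole space.\<close>
  have dct: "integrable lborel (\<lambda>x. Q (u x) (v x) x)"
      "(\<lambda>k. \<integral>x. Q (W (r k) x) (B (r k) x) x \<partial>lborel) \<longlonglongrightarrow> (\<integral>x. Q (u x) (v x) x \<partial>lborel)"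
    if meas: "(\<lambda>x. Q (u x) (v x) x) \<in> borel_measurable borel" "\<And>k. (\<lambda>x. Q (W k x) (B k x) x) \<in> borel_measurable borel"
      and bound: "\<And>w A x. \<bar>Q w A x\<bar> \<le> C * (indicator K x + power_norm w A)" and C: "0 \<le> C"
      and cont: "\<And>x w A ws As. ws \<longlonglongrightarrow> w \<Longrightarrow> (\<And>i j. (\<lambda>k. As k $ i $ j) \<longlonglongrightarrow> A $ i $ j) \<Longrightarrow>
        (\<lambda>k. Q (ws k) (As k) x) \<longlonglongrightarrow> Q w A x"
    for Q :: "real^'n \<Rightarrow> real^'n^'n \<Rightarrow> real^'n \<Rightarrow> real" and C
  proof -
    \<comment> \<open>The mollified pair is (u, v) plus its error, so
      \<open>power_norm_add_le\<close> gives the factor 2^n, and h dominates the errors for all k at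
      once.\<close>
    let ?w = "\<lambda>x. C * (indicator K x + 2 ^ ?n * (power_norm (u x) (v x) + h x))"
    have K_int: "integrable lborel (indicator K :: real^'n \<Rightarrow> real)"
      using borel_integrable_compact[OF K(1), of "\<lambda>_. 1::real"] by simp
    have w: "integrable lborel ?w"
      using K_int h pn_int by simp
    have lim: "AE x in lborel. (\<lambda>k. Q (W (r k) x) (B (r k) x) x) \<longlonglongrightarrow> Q (u x) (v x) x"
      using S_lim
    proof eventually_elim
      case (elim x)
      show ?case
        by (intro cont vec_tendstoI lim_component[OF _ elim] S_ge)
    qed
    have dom: "AE x in lborel. norm (Q (W (r k) x) (B (r k) x) x) \<le> ?w x" for k
      using S_h
    proof eventually_elim
      case (elim x)
      have "power_norm (W (r k) x) (B (r k) x) = power_norm (u x + (W (r k) x - u x)) (v x + (B (r k) x - v x))"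
        by simp
      also have "\<dots> \<le> 2 ^ ?n * (power_norm (u x) (v x) + S (r k) x)"
        unfolding S_def by (rule power_norm_add_le)
      also have "\<dots> \<le> 2 ^ ?n * (power_norm (u x) (v x) + h x)"
        using elim by simp
      finally have "C * (indicator K x + power_norm (W (r k) x) (B (r k) x)) \<le> ?w x"
        using C by (intro mult_left_mono add_left_mono) auto
      then show ?case using bound[of "W (r k) x" "B (r k) x" x] by simp
    qed
    show "integrable lborel (\<lambda>x. Q (u x) (v x) x)"
      by (rule integrable_dominated_convergence[OF _ _ w lim dom]) (use meas in auto)
    show "(\<lambda>k. \<integral>x. Q (W (r k) x) (B (r k) x) x \<partial>lborel) \<longlonglongrightarrow> (\<integral>x. Q (u x) (v x) x \<partial>lborel)"
      by (rule integral_dominated_convergence[OF _ _ w lim dom]) (use meas in auto)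
  qed

  have contV: "continuous_on UNIV V" and cont\<phi>: "continuous_on UNIV \<phi>"
    using V \<phi> by (auto intro!: continuous_at_imp_continuous_on intro: has_derivative_continuous)
  have contVj: "continuous_on UNIV (\<lambda>w. V w $ j)" and contgj: "continuous_on UNIV (\<lambda>x. g x $ j)" for j
    by (intro continuous_intros contV g)+
  have contDVj: "continuous_on UNIV (\<lambda>w. DV w $ i $ j)" for i j
    by (intro continuous_intros DV)
  have [measurable]: "(\<lambda>w. V w $ j) \<in> borel_measurable borel" "(\<lambda>x. g x $ j) \<in> borel_measurable borel"
      "\<phi> \<in> borel_measurable borel" "(\<lambda>w. DV w $ i $ j) \<in> borel_measurable borel" for i j
    by (intro borel_measurable_continuous_onI contVj contgj cont\<phi> contDVj)+
  have g0: "g x = 0" if "x \<notin> K" for x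
    using has_derivative_zero_outside[OF \<phi> compact_imp_closed[OF K(1)] K(2) that] inner_eq_zero_iff
    by metis
  obtain Mg where Mg: "\<And>x. \<bar>norm (g x)\<bar> \<le> Mg"
    using bounded_compact_support[OF continuous_on_norm[OF g] K(1)] g0 by (metis norm_zero)
  obtain M\<phi> where M\<phi>: "0 \<le> M\<phi>" "\<And>x. \<bar>\<phi> x\<bar> \<le> M\<phi>"
    using bounded_compact_support[OF cont\<phi> K] by blast
  obtain b where b: "\<And>y. norm (DV y) \<le> b"
    using DVbdd by (auto simp: bounded_iff)
  have bij: "\<bar>DV y $ i $ j\<bar> \<le> b" for y i j
    using component_le_norm_cart[of "DV y $ i" j] Finite_Cartesian_Product.norm_nth_le[of "DV y" i] b[of y] by linarith
  have b0: "0 \<le> b" using bij order.trans[OF abs_ge_zero] by blast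
  have "\<exists>L. \<forall>w. norm (V w) \<le> L * (1 + norm w)"
  proof -
    \<comment> \<open>Bounds the operator norm of an n by n matrix with entries at most b in
      absolute value; the mean value inequality then makes V Lipschitz, hence of linear
      growth.\<close>
    let ?b = "real ?n * real ?n * b"
    have "norm (V w) \<le> (norm (V 0) + ?b) * (1 + norm w)" for w
    proof -
      have "norm (V w - V 0) \<le> ?b * norm (w - 0)"
        by (rule differentiable_bound[where S=UNIV and f'="\<lambda>y. (*v) (DV y)"])
          (auto intro: V onorm_le_matrix_component bij)
      then have "norm (V w) \<le> norm (V 0) + ?b * norm w"
        using norm_triangle_sub[of "V w" "V 0"] by simp
      \<comment> \<open>The nonnegative cross terms are added to turn the bound into the product
        required by \<open>adj_mult_growth\<close>.\<close>
      also have "\<dots> \<le> norm (V 0) + ?b * norm w + (norm (V 0) * norm w + ?b)"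
        using b0 by simp
      finally show ?thesis by (simp add: algebra_simps)
    qed
    then show ?thesis by blast
  qed
  then obtain L where "\<And>w. norm (V w) \<le> L * (1 + norm w)" by blast
  from adj_mult_growth[OF this] obtain C where C: "0 \<le> C"
      "\<And>A w i j. \<bar>adj A $ i $ j * V w $ j\<bar> \<le> C * (1 + power_norm w A)" by blast

  let ?Q1 = "\<lambda>w A x. (adj A *v V w) \<bullet> g x"
  have Q1: "?Q1 w A x = (\<Sum>i\<in>UNIV. \<Sum>j\<in>UNIV. adj A $ i $ j * V w $ j * g x $ i)" for w A x
    by (simp add: inner_vec_def matrix_vector_mult_def sum_distrib_right)
  have "(\<lambda>x. ?Q1 (a x) (A x) x) \<in> borel_measurable borel"
    if [measurable]: "a \<in> borel_measurable borel" "\<And>i j. (\<lambda>x. A x $ i $ j) \<in> borel_measurable borel" for a A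
  proof -
    have [measurable]: "(\<lambda>x. adj (A x) $ i $ j) \<in> borel_measurable borel" for i j
      by (rule borel_measurable_adj) (rule that)
    show ?thesis unfolding Q1 by measurable
  qed
  note Q1_meas = this
  have Q1_bound: "\<bar>?Q1 w A x\<bar> \<le> (real ?n * real ?n * C * Mg) * (indicator K x + power_norm w A)" for w A x
  proof (cases "x \<in> K")
    case True
    have "\<bar>?Q1 w A x\<bar> \<le> (\<Sum>i\<in>UNIV. \<Sum>j\<in>UNIV. \<bar>adj A $ i $ j * V w $ j * g x $ i\<bar>)"
      unfolding Q1 by (intro order.trans[OF sum_abs] sum_mono sum_abs)
    also have "\<dots> \<le> (\<Sum>i\<in>(UNIV::'n set). \<Sum>j\<in>(UNIV::'n set). (C * (1 + power_norm w A)) * Mg)"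
    proof (intro sum_mono)
      fix i j :: 'n
      have "\<bar>g x $ i\<bar> \<le> Mg" using component_le_norm_cart[of "g x" i] Mg[of x] by simp
      then show "\<bar>adj A $ i $ j * V w $ j * g x $ i\<bar> \<le> (C * (1 + power_norm w A)) * Mg"
        unfolding abs_mult[of _ "g x $ i"]
        using C power_norm_nonneg[of w A] by (intro mult_mono) auto
    qed
    also have "\<dots> = (real ?n * real ?n * C * Mg) * (indicator K x + power_norm w A)"
      using True by simp
    finally show ?thesis .
  next
    case False
    have "0 \<le> Mg" using Mg order.trans[OF abs_ge_zero] by blast
    then show ?thesis using False C by (simp add: g0 power_norm_nonneg)
  qed
  have Q1_cont: "(\<lambda>k. ?Q1 (ws k) (As k) x) \<longlonglongrightarrow> ?Q1 w A x"
    if "ws \<longlonglongrightarrow> w" "\<And>i j. (\<lambda>k. As k $ i $ j) \<longlonglongrightarrow> A $ i $ j" for ws As x w A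
    unfolding Q1
    by (intro tendsto_intros tendsto_adj that continuous_on_tendsto_compose[OF contVj that(1)]) auto
  have "0 \<le> real ?n * real ?n * C * Mg"
    using C Mg order.trans[OF abs_ge_zero] by (metis mult_nonneg_nonneg of_nat_0_le_iff)
  note Q1_dct = dct[of ?Q1, OF Q1_meas[OF u v] Q1_meas Q1_bound this Q1_cont]

  let ?Q2 = "\<lambda>w A x. mtrace (DV w) * det A * \<phi> x"
  have Q2_meas: "(\<lambda>x. ?Q2 (a x) (A x) x) \<in> borel_measurable borel"
    if [measurable]: "a \<in> borel_measurable borel" "\<And>i j. (\<lambda>x. A x $ i $ j) \<in> borel_measurable borel" for a A
  proof -
    have [measurable]: "(\<lambda>x. det (A x)) \<in> borel_measurable borel"
      by (rule borel_measurable_det) (rule that)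
    show ?thesis unfolding mtrace_def by measurable
  qed
  have Q2_bound: "\<bar>?Q2 w A x\<bar> \<le> (real ?n * b * fact ?n * M\<phi>) * (indicator K x + power_norm w A)" for w A x
  proof -
    have "\<bar>mtrace (DV w)\<bar> \<le> (\<Sum>i\<in>(UNIV::'n set). b)"
      unfolding mtrace_def by (intro order.trans[OF sum_abs] sum_mono bij)
    then have 1: "\<bar>mtrace (DV w)\<bar> \<le> real ?n * b" by simp
    have "(\<Sum>k\<in>UNIV. \<Sum>l\<in>UNIV. \<bar>A $ k $ l\<bar> ^ ?n) \<le> indicator K x + power_norm w A"
      unfolding power_norm_def using sum_nonneg[of UNIV "\<lambda>i. \<bar>w $ i\<bar> ^ ?n"] by (auto simp: indicator_def)
    then have 2: "\<bar>det A\<bar> \<le> fact ?n * (indicator K x + power_norm w A)"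
      using abs_det_le[of A] mult_left_mono[of _ _ "fact ?n :: real"] by (meson fact_ge_zero order.trans)
    have "\<bar>?Q2 w A x\<bar> \<le> (real ?n * b) * (fact ?n * (indicator K x + power_norm w A)) * M\<phi>"
      unfolding abs_mult using 1 2 M\<phi> b0 power_norm_nonneg[of w A]
      by (intro mult_mono mult_nonneg_nonneg) auto
    then show ?thesis by (simp add: mult_ac)
  qed
  have Q2_cont: "(\<lambda>k. ?Q2 (ws k) (As k) x) \<longlonglongrightarrow> ?Q2 w A x"
    if "ws \<longlonglongrightarrow> w" "\<And>i j. (\<lambda>k. As k $ i $ j) \<longlonglongrightarrow> A $ i $ j" for ws As x w A
    unfolding mtrace_def
    by (intro tendsto_intros tendsto_det that continuous_on_tendsto_compose[OF contDVj that(1)]) auto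
  have "0 \<le> real ?n * b * fact ?n * M\<phi>" using b0 M\<phi> by simp
  note Q2_dct = dct[of ?Q2, OF Q2_meas[OF u v] Q2_meas Q2_bound this Q2_cont]

  show "integrable lborel (\<lambda>x. ?Q1 (u x) (v x) x)"
    by (rule Q1_dct(1)) measurable
  show "integrable lborel (\<lambda>x. ?Q2 (u x) (v x) x)"
    by (rule Q2_dct(1)) measurable
  have "(\<lambda>k. \<integral>x. ?Q1 (W (r k) x) (B (r k) x) x \<partial>lborel) \<longlonglongrightarrow> (\<integral>x. ?Q1 (u x) (v x) x \<partial>lborel)"
    by (rule Q1_dct(2)) measurable
  moreover have "(\<lambda>k. \<integral>x. ?Q2 (W (r k) x) (B (r k) x) x \<partial>lborel) \<longlonglongrightarrow> (\<integral>x. ?Q2 (u x) (v x) x \<partial>lborel)"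
    by (rule Q2_dct(2)) measurable
  ultimately show "(\<integral>x. ?Q1 (u x) (v x) x \<partial>lborel) = - (\<integral>x. ?Q2 (u x) (v x) x \<partial>lborel)"
    unfolding ident using LIMSEQ_unique tendsto_minus by blast
qed

text \<open>Local control becomes global by cutting off at a compact set, where finite measure also
  turns L^p into L^1; the completion of the measure supplies the Borel version.\<close>

lemma Lp_loc_borel_representative:
  fixes f :: "real^'n \<Rightarrow> real"
  assumes f: "Lp_loc (real p) \<Omega> f" and p: "1 \<le> p" and K: "compact K" "K \<subseteq> \<Omega>"
  obtains u where "u \<in> borel_measurable borel"
    "AE x in lborel. x \<in> K \<longrightarrow> u x = f x" "integrable lborel u" "integrable lborel (\<lambda>x. \<bar>u x\<bar> ^ p)"
proof -
  have [measurable]: "K \<in> sets borel" using K(1) by (simp add: borel_compact)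
  have "set_borel_measurable lebesgue K f"
    using f K(2) by (intro set_borel_measurable_subset[of lebesgue \<Omega> f K]) (auto simp: Lp_loc_def)
  then have "(\<lambda>x. indicator K x *\<^sub>R f x) \<in> borel_measurable lebesgue"
    by (simp add: set_borel_measurable_def)
  from completion_ex_borel_measurable_real[OF this] obtain u0
    where u0[measurable]: "u0 \<in> borel_measurable borel" and eq: "AE x in lborel. indicator K x *\<^sub>R f x = u0 x"
    by auto
  \<comment> \<open>The Borel version vanishes off K only almost everywhere, so it is cut off once
    more to vanish there exactly.\<close>
  define u where "u x = indicator K x * u0 x" for x
  have meas[measurable]: "u \<in> borel_measurable borel" unfolding u_def[abs_def] by measurable
  have AE: "AE x in lborel. x \<in> K \<longrightarrow> u x = f x"
    using eq by eventually_elim (auto simp: u_def)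
  have out: "u x = 0" if "x \<notin> K" for x using that by (simp add: u_def)
  have "integrable lebesgue (\<lambda>x. indicator K x *\<^sub>R \<bar>f x\<bar> powr real p)"
    using f K by (auto simp: Lp_loc_def set_integrable_def)
  moreover have "AE x in lborel. \<bar>u x\<bar> ^ p = indicator K x *\<^sub>R \<bar>f x\<bar> powr real p"
    using AE
  proof eventually_elim
    case (elim x)
    \<comment> \<open>At f x = 0 the real power \<open>powr\<close> is 0 by convention, and the
      natural power agrees because p \<ge> 1.\<close>
    have "\<bar>f x\<bar> powr real p = \<bar>f x\<bar> ^ p"
      using p by (cases "f x = 0") (auto simp: powr_realpow power_0_left)
    then show ?case using elim out[of x] p by (cases "x \<in> K") (auto simp: power_0_left)
  qed
  ultimately have pow: "integrable lborel (\<lambda>x. \<bar>u x\<bar> ^ p)"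
    by (subst (asm) lebesgue_integral_AE_borel(1)[of "\<lambda>x. \<bar>u x\<bar> ^ p"]) auto
  have int: "integrable lborel u"
  proof (rule Bochner_Integration.integrable_bound)
    show "integrable lborel (\<lambda>x. indicator K x + \<bar>u x\<bar> ^ p)"
      using pow borel_integrable_compact[OF K(1), of "\<lambda>_. 1::real"] by simp
    show "AE x in lborel. norm (u x) \<le> norm (indicator K x + \<bar>u x\<bar> ^ p)"
    proof (rule AE_I2)
      fix x
      show "norm (u x) \<le> norm (indicator K x + \<bar>u x\<bar> ^ p)"
        using le_one_plus_power[OF p, of "\<bar>u x\<bar>"] out[of x] by (cases "x \<in> K") auto
    qed
  qed measurable
  show thesis by (rule that[OF meas AE int pow])
qed

section \<open>Gradients of test functions and the conclusion for F\<close>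

lemma has_derivative_grad:
  fixes f :: "real^'n \<Rightarrow> real"
  assumes "f differentiable (at x)"
  shows "(f has_derivative (\<lambda>h. grad f x \<bullet> h)) (at x)"
proof -
  let ?f' = "frechet_derivative f (at x)"
  have d: "(f has_derivative ?f') (at x)" using assms by (simp add: frechet_derivative_works)
  then have lin: "linear ?f'" by (rule has_derivative_linear)
  have "?f' h = grad f x \<bullet> h" for h
  proof -
    have "?f' h = ?f' (\<Sum>j\<in>UNIV. h $ j *\<^sub>R axis j 1)"
      by (simp add: basis_expansion[where 'a=real, unfolded scalar_mult_eq_scaleR])
    also have "\<dots> = (\<Sum>j\<in>UNIV. h $ j * ?f' (axis j 1))"
      by (simp add: linear_sum[OF lin] linear_scale[OF lin])
    finally show ?thesis
      by (simp add: grad_def partial_deriv_def inner_vec_def mult.commute)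
  qed
  then have "?f' = (\<lambda>h. grad f x \<bullet> h)" by (rule ext)
  with d show ?thesis by simp
qed

lemma continuous_on_grad:
  fixes f :: "real^'n \<Rightarrow> real"
  assumes "smooth_fun f"
  shows "continuous_on UNIV (grad f)"
proof -
  have "f \<in> Ck_fun (Suc 0)" using assms by (simp only: smooth_fun_def)
  then show ?thesis unfolding grad_def[abs_def] by (intro continuous_on_vec_lambda) simp
qed

text \<open>Both integrability claims belong to the conclusion: the integral of a non-integrable
  function is 0 by convention, so the equation alone would not express the distributional identity.
  The divergence of V is the trace of its derivative DV.\<close>

theorem theorem2p1:
  fixes \<Omega> :: "(real^'n::finite) set"
    and F :: "real^'n \<Rightarrow> real^'n" and DF :: "real^'n \<Rightarrow> real^'n^'n"
    and V :: "real^'n \<Rightarrow> real^'n" and DV :: "real^'n \<Rightarrow> real^'n^'n"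
  assumes n2: "CARD('n) \<ge> 2"
    and dom: "open \<Omega>" "connected \<Omega>" "\<Omega> \<noteq> {}"
    and sob: "W1p_loc (real CARD('n)) \<Omega> F DF"
    and Vder: "\<And>y. (V has_derivative (\<lambda>h. DV y *v h)) (at y)"
    and DVcont: "continuous_on UNIV DV"
    and DVbdd: "bounded (range DV)"
  shows "\<forall>\<phi>. test_fun \<Omega> \<phi> \<longrightarrow>
    set_integrable lebesgue \<Omega> (\<lambda>x. (adj (DF x) *v V (F x)) \<bullet> grad \<phi> x) \<and>
    set_integrable lebesgue \<Omega> (\<lambda>x. mtrace (DV (F x)) * det (DF x) * \<phi> x) \<and>
    - (LINT x:\<Omega>|lebesgue. (adj (DF x) *v V (F x)) \<bullet> grad \<phi> x)
      = (LINT x:\<Omega>|lebesgue. mtrace (DV (F x)) * det (DF x) * \<phi> x)"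
proof (intro allI impI)
  fix \<phi> assume test: "test_fun \<Omega> \<phi>"
  define K where "K = closure {x. \<phi> x \<noteq> 0}"
  have K: "compact K" "K \<subseteq> \<Omega>" and smooth: "smooth_fun \<phi>"
    using test by (auto simp: test_fun_def K_def)
  have \<phi>0: "\<phi> x = 0" if "x \<notin> K" for x
    using that closure_subset[of "{x. \<phi> x \<noteq> 0}"] by (auto simp: K_def)
  have "\<phi> \<in> Ck_fun (Suc 0)" using smooth by (simp only: smooth_fun_def)
  then have \<phi>_der: "(\<phi> has_derivative (\<lambda>h. grad \<phi> x \<bullet> h)) (at x)" for x
    by (intro has_derivative_grad) simp
  have grad0: "grad \<phi> x = 0" if "x \<notin> K" for x
    using has_derivative_zero_outside[OF \<phi>_der compact_imp_closed[OF K(1)] \<phi>0 that] inner_eq_zero_iff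
    by metis
  obtain \<delta> where \<delta>: "0 < \<delta>" "(\<Union>x\<in>K. cball x \<delta>) \<subseteq> \<Omega>"
    using compact_subset_open_imp_cball_epsilon_subset[OF K(1) dom(1) K(2)] by blast
  \<comment> \<open>The closed \<delta>-neighbourhood of the support K. Every kernel of radius e <
    \<delta> centred in K lives inside L, so truncating F and DF to L does not affect tests with
    these kernels.\<close>
  define L where "L = {x + y | x y. x \<in> K \<and> y \<in> cball 0 \<delta>}"
  have L_compact: "compact L"
    unfolding L_def by (intro compact_sums K compact_cball)
  have mem_L: "y \<in> L" if "x \<in> K" "y - x \<in> cball 0 \<delta>" for x y
    unfolding L_def using that by (intro CollectI exI[of _ x] exI[of _ "y - x"]) auto
  have "L \<subseteq> \<Omega>"
    using \<delta>(2) unfolding L_def by (force simp: dist_norm)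
  have "K \<subseteq> L"
    using mem_L \<delta>(1) by force
  have n: "1 \<le> CARD('n)" by simp
  define rep where "rep f w \<longleftrightarrow> w \<in> borel_measurable borel \<and> (AE x in lborel. x \<in> L \<longrightarrow> w x = f x)
      \<and> integrable lborel w \<and> integrable lborel (\<lambda>x. \<bar>w x\<bar> ^ CARD('n))" for f w :: "real^'n \<Rightarrow> real"
  have ex_rep: "\<exists>w. rep f w" if "Lp_loc (real CARD('n)) \<Omega> f" for f
    using Lp_loc_borel_representative[OF that n L_compact \<open>L \<subseteq> \<Omega>\<close>] unfolding rep_def by blast
  have "\<forall>i. \<exists>w. rep (\<lambda>x. F x $ i) w" "\<forall>i j. \<exists>w. rep (\<lambda>x. DF x $ i $ j) w"
    using sob by (auto simp: W1p_loc_def intro: ex_rep)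
  then obtain u0 v0 where "\<And>i. rep (\<lambda>x. F x $ i) (u0 i)" "\<And>i j. rep (\<lambda>x. DF x $ i $ j) (v0 i j)"
    by metis
  then have u0: "u0 i \<in> borel_measurable borel" "AE x in lborel. x \<in> L \<longrightarrow> u0 i x = F x $ i"
      "integrable lborel (u0 i)" "integrable lborel (\<lambda>x. \<bar>u0 i x\<bar> ^ CARD('n))"
    and v0: "v0 i j \<in> borel_measurable borel" "AE x in lborel. x \<in> L \<longrightarrow> v0 i j x = DF x $ i $ j"
      "integrable lborel (\<lambda>x. \<bar>v0 i j x\<bar> ^ CARD('n))" for i j
    unfolding rep_def by auto
  define u where "u x = (\<chi> i. u0 i x)" for x
  define v :: "real^'n \<Rightarrow> real^'n^'n" where "v x = (\<chi> i j. v0 i j x)" for x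
  have u_meas: "u \<in> borel_measurable borel"
  proof (subst borel_measurable_euclidean_space, rule ballI)
    fix b :: "real^'n" assume "b \<in> Basis"
    then obtain i where "b = axis i 1" by (auto simp: Basis_vec_def)
    then show "(\<lambda>x. u x \<bullet> b) \<in> borel_measurable borel"
      using u0(1) by (simp add: u_def inner_axis)
  qed
  have u_AE: "AE x in lborel. x \<in> L \<longrightarrow> u x = F x"
  proof -
    have "AE x in lborel. \<forall>i\<in>UNIV. x \<in> L \<longrightarrow> u0 i x = F x $ i"
      by (rule AE_finite_allI) (auto intro: u0(2))
    then show ?thesis by eventually_elim (auto simp: u_def vec_eq_iff)
  qed
  have v_AE: "AE x in lborel. x \<in> L \<longrightarrow> v x = DF x"
  proof -
    have "AE x in lborel. \<forall>i\<in>UNIV. \<forall>j\<in>UNIV. x \<in> L \<longrightarrow> v0 i j x = DF x $ i $ j"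
      by (intro AE_finite_allI) (auto intro: v0(2))
    then show ?thesis by eventually_elim (auto simp: v_def vec_eq_iff)
  qed
  \<comment> \<open>The kernel vanishes off L, and on L the representative w equals f almost
    everywhere, so the two integrands agree almost everywhere although w and f may differ elsewhere
    in \<Omega>.\<close>
  have localise: "(LINT y:\<Omega>|lebesgue. f y * \<eta> (y - x)) = (\<integral>y. w y * \<eta> (y - x) \<partial>lborel)"
    if w: "w \<in> borel_measurable borel" "AE y in lborel. y \<in> L \<longrightarrow> w y = f y"
      and \<eta>: "continuous_on UNIV \<eta>" "\<And>z. z \<notin> cball 0 e \<Longrightarrow> \<eta> z = 0"
      and x: "x \<in> K" and e: "e < \<delta>" for f w \<eta> :: "real^'n \<Rightarrow> real" and x e
    unfolding set_lebesgue_integral_def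
  proof (rule lebesgue_integral_AE_borel(2))
    have [measurable]: "\<eta> \<in> borel_measurable borel" "w \<in> borel_measurable borel"
      using \<eta>(1) w(1) by (auto intro: borel_measurable_continuous_onI)
    show "(\<lambda>y. w y * \<eta> (y - x)) \<in> borel_measurable borel" by measurable
    show "AE y in lborel. w y * \<eta> (y - x) = indicator \<Omega> y *\<^sub>R (f y * \<eta> (y - x))"
      using w(2)
    proof eventually_elim
      case (elim y)
      show ?case
      proof (cases "y - x \<in> cball 0 e")
        case True
        then have "y \<in> L" using e by (intro mem_L[OF x]) auto
        then show ?thesis using elim \<open>L \<subseteq> \<Omega>\<close> by (auto simp: indicator_def)
      qed (simp add: \<eta>(2))
    qed
  qed
  \<comment> \<open>The definition of the weak derivative, tested with the kernel centred at x; the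
    choice of \<delta> keeps its support in \<Omega>.\<close>
  have weak: "(\<integral>y. u y $ i * bump1 e j (y - x) \<partial>lborel) = - (\<integral>y. v y $ i $ j * bump e (y - x) \<partial>lborel)"
    if e: "0 < e" "e < \<delta>" and x: "x \<in> K" for e x i j
  proof -
    have "cball x e \<subseteq> cball x \<delta>" using e by auto
    then have "test_fun \<Omega> (\<lambda>y. bump e (y - x))"
      using \<delta>(2) x e by (intro test_fun_bump) blast+
    then have "(LINT y:\<Omega>|lebesgue. F y $ i * partial_deriv j (\<lambda>y. bump e (y - x)) y) = - (LINT y:\<Omega>|lebesgue. DF y $ i $ j * bump e (y - x))"
      using sob unfolding W1p_loc_def weak_jacobian_def by blast
    then show ?thesis
      unfolding partial_deriv_bump
      using localise[OF u0(1) u0(2)[of i] continuous_bump(2)[of e j] bump_outside(2)[OF e(1)] x e(2)]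
        localise[OF v0(1) v0(2)[of i j] continuous_bump(1)[of e] bump_outside(1)[OF e(1)] x e(2)]
      by (simp add: u_def v_def)
  qed
  have weak_id: "integrable lborel (\<lambda>x. (adj (v x) *v V (u x)) \<bullet> grad \<phi> x)"
    "integrable lborel (\<lambda>x. mtrace (DV (u x)) * det (v x) * \<phi> x)"
    "(\<integral>x. (adj (v x) *v V (u x)) \<bullet> grad \<phi> x \<partial>lborel) = - (\<integral>x. mtrace (DV (u x)) * det (v x) * \<phi> x \<partial>lborel)"
    using weak_divergence_identity[OF u_meas _ _ _ _ \<delta>(1) weak Vder DVcont DVbdd \<phi>_der continuous_on_grad[OF smooth] K(1) \<phi>0]
      u0(3,4) v0(1,3) by (simp_all add: u_def v_def)
  \<comment> \<open>Agreement on K is enough to return to F and DF, since \<phi> and its gradient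
    vanish off K and thus remove all other values from both integrands.\<close>
  have uv: "AE x in lborel. x \<in> K \<longrightarrow> u x = F x \<and> v x = DF x"
    using u_AE v_AE by eventually_elim (use \<open>K \<subseteq> L\<close> in auto)
  have AE1: "AE x in lborel. (adj (v x) *v V (u x)) \<bullet> grad \<phi> x
      = indicator \<Omega> x *\<^sub>R ((adj (DF x) *v V (F x)) \<bullet> grad \<phi> x)"
    using uv
  proof eventually_elim
    case (elim x)
    then show ?case using K(2) grad0[of x] by (cases "x \<in> K") auto
  qed
  have AE2: "AE x in lborel. mtrace (DV (u x)) * det (v x) * \<phi> x
      = indicator \<Omega> x *\<^sub>R (mtrace (DV (F x)) * det (DF x) * \<phi> x)"
    using uv
  proof eventually_elim
    case (elim x)
    then show ?case using K(2) \<phi>0[of x] by (cases "x \<in> K") auto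
  qed
  have m: "(\<lambda>x. (adj (v x) *v V (u x)) \<bullet> grad \<phi> x) \<in> borel_measurable borel"
    "(\<lambda>x. mtrace (DV (u x)) * det (v x) * \<phi> x) \<in> borel_measurable borel"
    using weak_id(1,2)[THEN borel_measurable_integrable] by simp_all
  show "set_integrable lebesgue \<Omega> (\<lambda>x. (adj (DF x) *v V (F x)) \<bullet> grad \<phi> x) \<and>
    set_integrable lebesgue \<Omega> (\<lambda>x. mtrace (DV (F x)) * det (DF x) * \<phi> x) \<and>
    - (LINT x:\<Omega>|lebesgue. (adj (DF x) *v V (F x)) \<bullet> grad \<phi> x)
      = (LINT x:\<Omega>|lebesgue. mtrace (DV (F x)) * det (DF x) * \<phi> x)"
    unfolding set_integrable_def set_lebesgue_integral_def
    using weak_id lebesgue_integral_AE_borel[OF m(1) AE1] lebesgue_integral_AE_borel[OF m(2) AE2] by simp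
qed

end
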